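(* Let $K\subset[0,1]^2$ be a convex body. Let $(\theta_i)_{i\in\mathbb{N}}$ be a dense sequence in $[0,2\pi)$ such that $\theta_i\neq\theta_j$ for $i\ne j$ and $(\theta_1,\theta_2,\theta_3,\theta_4)=(0,\frac{\pi}{2},\pi,\frac{3\pi}{2})$. For $n\ge4$ let $\theta_{(1)}<\dots<\theta_{(n)}$ denote $\theta_1,\dots,\theta_n$ arranged in increasing order. For each $N\in\mathbb{N}_0$ let $\epsilon_{Nkl}$, $k,l=0,\dots,N$, be real random variables on a complete probability space $(\Omega,\mathcal{F},\mathbb{P})$ with zero means and finite variances bounded by a constant $\sigma_N^2$, and let $\tilde\lambda_{kl}(K)=\lambda_{kl}(K)+\epsilon_{Nkl}$, $k,l=0,\dots,N$, be the corresponding noisy measurements of the Legendre moments of $K$. Let $\mathbb{P}_{N,n}(\epsilon)$ denote the random set of all least squares estimators of $K$ with respect to these measurements on the space $\mathcal{P}(\theta_{(1)},\dots,\theta_{(n)})$. (i) If $\sigma_N^2=\mathcal{O}\left(\frac{1}{N^{2+\varepsilon}}\right)$ for some $\varepsilon>0$, then $\sup_{P\in\mathbb{P}_{N,n}(\epsilon)}\delta_N(K,P)\to0$ in mean and in probability for $n,N\to\infty$. (ii) If $\sigma_N^2=\mathcal{O}\left(\frac{1}{N^{3+\varepsilon}}\right)$ for some $\varepsilon>0$, then $\sup_{P\in\mathbb{P}_{N,n}(\epsilon)}\delta_N(K,P)\to0$ almost surely for $n,N\to\infty$.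
   Context: A convex body is a compact, convex subset of $\mathbb{R}^2$ with nonempty interior. For angles $0\le\theta_1<\dots<\theta_n<2\pi$ put $u_i=(\cos\theta_i,\sin\theta_i)^\top$ and assume $\{\sum_{i=1}^n\lambda_iu_i:\lambda_i\ge0\}=\mathbb{R}^2$. For $h_1,\dots,h_n\in\mathbb{R}$ let $P(h_1,\dots,h_n)=\bigcap_{i=1}^n\{x\in\mathbb{R}^2:\langle x,u_i\rangle\le h_i\}$. The vector $(h_1,\dots,h_n)$ is called consistent with respect to $(\theta_1,\dots,\theta_n)$ if $P(h_1,\dots,h_n)$ has support function value $h_i$ in direction $u_i$ for $1\le i\le n$. $\mathcal{P}(\theta_1,\dots,\theta_n)$ is the set of polygons $P(h_1,\dots,h_n)\subset[0,1]^2$ with $(h_1,\dots,h_n)$ consistent with respect to $(\theta_1,\dots,\theta_n)$ (such polygons may have empty interior). For compact $K\subset[0,1]^2$ and $k,l\in\mathbb{N}_0$, the Legendre moments are $\lambda_{kl}(K)=\int_KL_k(x_1)L_l(x_2)\,d(x_1,x_2)$, where $L_i:[0,1]\to\mathbb{R}$, $i\in\mathbb{N}_0$, are the shifted normalized Legendre polynomials, obtained by Gram-Schmidt orthonormalization of $1,x,x^2,\dots$ in $L^2([0,1])$. A least squares estimator of $K$ with respect to the measurements $\tilde\lambda_{kl}(K)$, $k,l=0,\dots,N$, on $\mathcal{P}(\theta_1,\dots,\theta_n)$ is any $P\in\mathcal{P}(\theta_1,\dots,\theta_n)$ minimizing $\sum_{k,l=0}^N(\tilde\lambda_{kl}(K)-\lambda_{kl}(P))^2$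 over $\mathcal{P}(\theta_1,\dots,\theta_n)$. For compact convex $K,L\subset[0,1]^2$, $\delta_N(K,L)$ is the area of the symmetric difference $(K\setminus L)\cup(L\setminus K)$ (the subscript in $\delta_N$ stands for Nikodym and is unrelated to the integer $N$). The function $\sup_{P\in\mathbb{P}_{N,n}(\epsilon)}\delta_N(K,P)$ is a (measurable) random variable on $(\Omega,\mathcal{F},\mathbb{P})$. Convergence in mean is $L^1$-convergence. *)

theory Defs
  imports
    "HOL-Probability.Probability"
    "HOL-Library.Landau_Symbols"
    "HOL-Computational_Algebra.Polynomial"
begin

definition unit_square :: "(real ^ 2) set" where
  "unit_square = {x. \<forall>i. 0 \<le> x $ i \<and> x $ i \<le> 1}"

definition convex_body :: "(real ^ 2) set \<Rightarrow> bool" where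
  "convex_body K \<longleftrightarrow> compact K \<and> convex K \<and> interior K \<noteq> {}"

definition support_fun :: "(real ^ 2) set \<Rightarrow> real ^ 2 \<Rightarrow> real" where
  "support_fun K v = (SUP x\<in>K. x \<bullet> v)"

definition unit_dir :: "real \<Rightarrow> real ^ 2" where
  "unit_dir t = vector [cos t, sin t]"

text \<open>
  Angles and the corresponding support values are given as lists of equal length.
\<close>

definition polygon :: "real list \<Rightarrow> real list \<Rightarrow> (real ^ 2) set" where
  "polygon ts hs = (\<Inter>i<length ts. {x. x \<bullet> unit_dir (ts ! i) \<le> hs ! i})"

text \<open>
  Nonemptiness is part of consistency, because the support function of the empty set is
  minus infinity and hence never a real number, whereas the real-valued \<^term>\<open>Sup\<close> of the
  empty set is an arbitrary real.
\<close>

definition consistent :: "real list \<Rightarrow> real list \<Rightarrow> bool" where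
  "consistent ts hs \<longleftrightarrow> length hs = length ts \<and> polygon ts hs \<noteq> {} \<and>
     (\<forall>i<length ts. support_fun (polygon ts hs) (unit_dir (ts ! i)) = hs ! i)"

definition polygons :: "real list \<Rightarrow> (real ^ 2) set set" where
  "polygons ts = {polygon ts hs | hs. consistent ts hs \<and> polygon ts hs \<subseteq> unit_square}"

definition inner_L2 :: "real poly \<Rightarrow> real poly \<Rightarrow> real" where
  "inner_L2 p q = (LINT x:{0..1}|lborel. poly p x * poly q x)"

text \<open>Shifted normalized Legendre polynomials: Gram-Schmidt applied to the monomials.\<close>

fun legendre :: "nat \<Rightarrow> real poly" where
  "legendre n =
     (let q = monom 1 n - (\<Sum>i<n. smult (inner_L2 (monom 1 n) (legendre i)) (legendre i))
      in smult (1 / sqrt (inner_L2 q q)) q)"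

declare legendre.simps [simp del]

definition legendre_moment :: "nat \<Rightarrow> nat \<Rightarrow> (real ^ 2) set \<Rightarrow> real" where
  "legendre_moment k l K =
     (LINT x:K|lborel. poly (legendre k) (x $ 1) * poly (legendre l) (x $ 2))"

definition moment_error ::
    "nat \<Rightarrow> (nat \<Rightarrow> nat \<Rightarrow> real) \<Rightarrow> (real ^ 2) set \<Rightarrow> real" where
  "moment_error N m P = (\<Sum>k\<le>N. \<Sum>l\<le>N. (m k l - legendre_moment k l P)\<^sup>2)"

definition least_squares_estimators ::
    "nat \<Rightarrow> (nat \<Rightarrow> nat \<Rightarrow> real) \<Rightarrow> real list \<Rightarrow> (real ^ 2) set set" where
  "least_squares_estimators N m ts =
     {P \<in> polygons ts. \<forall>Q\<in>polygons ts. moment_error N m P \<le> moment_error N m Q}"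

definition nikodym_dist :: "(real ^ 2) set \<Rightarrow> (real ^ 2) set \<Rightarrow> real" where
  "nikodym_dist K L = measure lborel (sym_diff K L)"

text \<open>
  Measurability is built into the two stochastic modes of convergence below, because
  \<^const>\<open>lebesgue_integral\<close> and \<^const>\<open>measure\<close> return 0 on non-measurable arguments.
\<close>

definition tendsto_in_mean ::
    "'w measure \<Rightarrow> ('i \<Rightarrow> 'w \<Rightarrow> real) \<Rightarrow> ('w \<Rightarrow> real) \<Rightarrow> 'i filter \<Rightarrow> bool" where
  "tendsto_in_mean M X Y F \<longleftrightarrow>
     (\<forall>\<^sub>F i in F. integrable M (X i)) \<and> integrable M Y \<and>
     ((\<lambda>i. \<integral>\<omega>. \<bar>X i \<omega> - Y \<omega>\<bar> \<partial>M) \<longlongrightarrow> 0) F"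

definition tendsto_in_prob ::
    "'w measure \<Rightarrow> ('i \<Rightarrow> 'w \<Rightarrow> real) \<Rightarrow> ('w \<Rightarrow> real) \<Rightarrow> 'i filter \<Rightarrow> bool" where
  "tendsto_in_prob M X Y F \<longleftrightarrow>
     (\<forall>\<^sub>F i in F. X i \<in> borel_measurable M) \<and> Y \<in> borel_measurable M \<and>
     (\<forall>e>0. ((\<lambda>i. measure M {\<omega> \<in> space M. \<bar>X i \<omega> - Y \<omega>\<bar> > e}) \<longlongrightarrow> 0) F)"

end

(* A convex set is stable under its moments: if compact convex sets P_j in the square satisfy
   sum_{k,l <= N_j} (lambda_kl(P_j) - lambda_kl(K))^2 -> 0 with N_j -> infinity, then a subsequence
   converges almost everywhere to a compact set B by Blaschke selection, B has the same Legendre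
   moments as K, and by Stone-Weierstrass B = K up to a null set. By contradiction, a small moment
   error up to a large order N forces a small Nikodym distance, uniformly over all convex P.

   For a least squares estimator P, comparison with the polygon Q_n circumscribed about K and
   Bessel's inequality bound the moment error of P by 4 delta_N(K, Q_n) + 6 E_N, where E_N is the
   sum of the squared noise terms. Density of the angles gives delta_N(K, Q_n) -> 0, while
   E(E_N) <= (N + 1)^2 sigma_N^2 tends to 0 in case (i) and is summable in case (ii).

   The worst error is a measurable function of the noise because it is upper semicontinuous: it is
   the maximum of a continuous function over the minimizers of a jointly continuous function on a
   compact parameter space. *)

theory Submission
  imports Defs
begin

section \<open>Legendre polynomials\<close>

text \<open>Finitely many moments do not determine a set, and the polygons range over classes of
  growing dimension. What rescues the argument is compactness of the class of all convex subsets of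
  the square; it yields a threshold without any rate, but one that is uniform over the estimators
  and does not depend on the sample point. The probabilistic part thereby shrinks to one random
  variable per N, the noise energy: for n and N beyond a fixed bound, the worst error exceeds a
  given level only if the energy exceeds some \<delta>. The exponents come from counting. There are
  (N + 1)^2 noise terms, which uses up two powers of N; a remaining power \<epsilon> suffices for
  convergence of the expected energy, and one further full power makes the expectations summable. K
  itself is in general no admissible competitor in the minimization, so a circumscribed polygon
  takes its place. The four axis directions keep the relevant polygons inside the square, which
  supplies boundedness, domination and compact parameter spaces alike.\<close>

lemma set_integrable_poly: "set_integrable lborel {0..1::real} (\<lambda>x. poly p x)"
  unfolding set_integrable_def
  by (rule borel_integrable_compact) (auto intro!: continuous_intros)

lemma inner_L2_commute: "inner_L2 p q = inner_L2 q p"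
  unfolding inner_L2_def by (simp add: mult.commute)

lemma inner_L2_add: "inner_L2 (p + q) r = inner_L2 p r + inner_L2 q r"
proof -
  have mult: "inner_L2 a b = set_lebesgue_integral lborel {0..1} (poly (a * b))" for a b
    unfolding inner_L2_def by (rule arg_cong[where f = "set_lebesgue_integral lborel {0..1}"]) auto
  have "inner_L2 (p + q) r = (LINT x:{0..1}|lborel. poly (p * r) x + poly (q * r) x)"
    unfolding inner_L2_def by (simp add: algebra_simps)
  also have "\<dots> = inner_L2 p r + inner_L2 q r"
    unfolding mult by (subst set_integral_add(2)) (auto intro: set_integrable_poly)
  finally show ?thesis .
qed

lemma inner_L2_smult: "inner_L2 (smult c p) r = c * inner_L2 p r"
  unfolding inner_L2_def by (simp add: mult.assoc)

lemma inner_L2_zero: "inner_L2 0 r = 0"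
  unfolding inner_L2_def by simp

lemma inner_L2_diff: "inner_L2 (p - q) r = inner_L2 p r - inner_L2 q r"
  using inner_L2_add[of p "smult (-1) q" r] inner_L2_smult[of "-1" q r] by simp

lemma inner_L2_sum: "inner_L2 (\<Sum>i\<in>A. f i) r = (\<Sum>i\<in>A. inner_L2 (f i) r)"
  by (induction A rule: infinite_finite_induct) (auto simp: inner_L2_zero inner_L2_add)

text \<open>A vanishing integral would make the square of \<open>p\<close> vanish almost everywhere
  on [0,1], but a nonzero polynomial has finitely many roots. This keeps the Gram-Schmidt
  normalization from dividing by 0.\<close>

lemma inner_L2_pos:
  assumes "p \<noteq> 0"
  shows "inner_L2 p p > 0"
proof -
  have int: "set_integrable lborel {0..1::real} (\<lambda>x. poly p x * poly p x)"
    using set_integrable_poly[of "p * p"] by simp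
  have "inner_L2 p p \<noteq> 0"
  proof
    assume "inner_L2 p p = 0"
    then have "AE x in lborel. indicator {0..1} x *\<^sub>R (poly p x * poly p x) = 0"
      using int unfolding inner_L2_def set_lebesgue_integral_def set_integrable_def
      by (subst (asm) integral_nonneg_eq_0_iff_AE) auto
    then have "AE x in lborel. x \<notin> {0..1} - {x. poly p x = 0}"
      by eventually_elim (auto simp: indicator_def)
    then have "emeasure lborel ({0..1} - {x. poly p x = 0}) = 0"
      using poly_roots_finite[OF assms]
      by (subst (asm) AE_iff_measurable[of "{0..1} - {x. poly p x = 0}"]) (auto simp: finite_imp_closed)
    moreover have "emeasure lborel ({0..1::real} - {x. poly p x = 0}) = emeasure lborel {0..1::real}"
      using poly_roots_finite[OF assms]
      by (intro emeasure_Diff_null_set) (auto simp: null_sets_def emeasure_lborel_countable countable_finite finite_imp_closed)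
    ultimately show False by simp
  qed
  moreover have "inner_L2 p p \<ge> 0"
    unfolding inner_L2_def set_lebesgue_integral_def by (intro integral_nonneg_AE) auto
  ultimately show ?thesis by simp
qed

definition gram_schmidt_residue :: "nat \<Rightarrow> real poly" where
  "gram_schmidt_residue n =
     monom 1 n - (\<Sum>i<n. smult (inner_L2 (monom 1 n) (legendre i)) (legendre i))"

lemma legendre_eq:
  "legendre n = smult (1 / sqrt (inner_L2 (gram_schmidt_residue n) (gram_schmidt_residue n)))
     (gram_schmidt_residue n)"
  by (subst legendre.simps) (simp add: Let_def gram_schmidt_residue_def)

text \<open>The subtracted projections have degree below \<open>n\<close>, so the residue keeps the
  leading coefficient 1 of the monomial.\<close>

lemma degree_legendre: "degree (legendre n) \<le> n"
  and gram_schmidt_residue_nonzero: "gram_schmidt_residue n \<noteq> 0"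
proof (induction n rule: less_induct)
  case (less n)
  have *: "coeff (\<Sum>i<n. smult (inner_L2 (monom 1 n) (legendre i)) (legendre i)) m = 0" if "m \<ge> n" for m
    using less that by (auto simp: coeff_sum intro!: sum.neutral coeff_eq_0) (metis coeff_eq_0 le_less_trans less_le_trans)
  { case 1
    show ?case
      unfolding legendre_eq
      by (rule order.trans[OF degree_smult_le], rule degree_le)
         (use * in \<open>auto simp: gram_schmidt_residue_def\<close>) }
  { case 2
    have "coeff (gram_schmidt_residue n) n = 1"
      using *[of n] by (simp add: gram_schmidt_residue_def)
    then show ?case by auto }
qed

lemma inner_L2_legendre: "inner_L2 (legendre m) (legendre n) = (if m = n then 1 else 0)"
proof -
  have norm: "inner_L2 (legendre n) (legendre n) = 1" for n
  proof -
    have "inner_L2 (smult c q) (smult c q) = c * (c * inner_L2 q q)" for c q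
      by (metis inner_L2_smult inner_L2_commute)
    then show ?thesis
      using inner_L2_pos[OF gram_schmidt_residue_nonzero, of n]
      by (simp add: legendre_eq[of n])
  qed
  have "\<forall>m<n. inner_L2 (legendre n) (legendre m) = 0" for n
  proof (induction n rule: less_induct)
    case (less n)
    have ortho: "inner_L2 (legendre i) (legendre m) = (if i = m then 1 else 0)"
      if "i < n" "m < n" for i m
      using less that norm inner_L2_commute by (metis linorder_neqE_nat)
    have "inner_L2 (gram_schmidt_residue n) (legendre m) = 0" if "m < n" for m
    proof -
      have "(\<Sum>i<n. inner_L2 (monom 1 n) (legendre i) * inner_L2 (legendre i) (legendre m)) =
            (\<Sum>i<n. if i = m then inner_L2 (monom 1 n) (legendre i) else 0)"
        using ortho that by (intro sum.cong) auto
      with that show ?thesis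
        by (simp add: gram_schmidt_residue_def inner_L2_diff inner_L2_sum inner_L2_smult)
    qed
    then show ?case by (simp add: legendre_eq[of n] inner_L2_smult)
  qed
  then show ?thesis using norm inner_L2_commute by (metis linorder_neqE_nat)
qed

text \<open>Each monomial is a residue, that is a multiple of a Legendre polynomial, plus a
  combination of earlier Legendre polynomials. Applied in one variable at a time, this turns
  vanishing moment differences into vanishing integrals of products of polynomials.\<close>

lemma poly_linear_vanish:
  fixes \<Phi> :: "real poly \<Rightarrow> real"
  assumes add: "\<And>p q. \<Phi> (p + q) = \<Phi> p + \<Phi> q"
    and smult: "\<And>c p. \<Phi> (smult c p) = c * \<Phi> p"
    and legendre: "\<And>n. \<Phi> (legendre n) = 0"
  shows "\<Phi> p = 0"
proof -
  have zero: "\<Phi> 0 = 0" using smult[of 0 0] by simp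
  have sum: "\<Phi> (\<Sum>i\<in>A. f i) = (\<Sum>i\<in>A. \<Phi> (f i))" for A :: "nat set" and f
    by (induction A rule: infinite_finite_induct) (auto simp: zero add)
  have "\<Phi> (monom 1 n) = 0" for n
  proof -
    have "\<Phi> (gram_schmidt_residue n) = 0"
      using legendre[of n] inner_L2_pos[OF gram_schmidt_residue_nonzero, of n]
      by (auto simp: legendre_eq[of n] smult)
    moreover have "monom 1 n = gram_schmidt_residue n +
        (\<Sum>i<n. smult (inner_L2 (monom 1 n) (legendre i)) (legendre i))"
      by (simp add: gram_schmidt_residue_def)
    ultimately show ?thesis by (metis (no_types, lifting) add sum smult legendre mult_zero_right sum.neutral add_0)
  qed
  then have "\<Phi> (monom c n) = 0" for c n
    using smult[of c "monom 1 n"] by (simp add: smult_monom)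
  then show ?thesis
    by (subst poly_as_sum_of_monoms[of p, symmetric]) (simp add: sum)
qed

section \<open>Legendre moments of subsets of the unit square\<close>

lemma unit_square_eq_cbox: "unit_square = cbox 0 1"
  by (auto simp: unit_square_def mem_box_cart)

lemma compact_unit_square: "compact unit_square"
  by (simp add: unit_square_eq_cbox)

lemma borel_unit_square [measurable]: "unit_square \<in> sets borel"
  by (simp add: unit_square_eq_cbox)

lemma Basis_real_2: "(Basis :: (real ^ 2) set) = {axis 1 1, axis 2 1}"
  unfolding Basis_vec_def by (auto simp: UNIV_2)

lemma axis_1_neq_2: "axis 1 (1::real) \<noteq> (axis 2 1 :: real ^ 2)"
  by (simp add: axis_eq_axis)

lemma set_integral_unit_square_prod:
  fixes f g :: "real \<Rightarrow> real"
  assumes "set_integrable lborel {0..1} f" "set_integrable lborel {0..1} g"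
  shows "(LINT x:unit_square|lborel. f (x $ 1) * g (x $ 2)) =
    (LINT x:{0..1}|lborel. f x) * (LINT x:{0..1}|lborel. g x)"
proof -
  interpret product_sigma_finite "\<lambda>_::real ^ 2. lborel :: real measure"
    by (rule product_sigma_finite.intro) (rule lborel.sigma_finite_measure_axioms)
  \<comment> \<open>Letting the basis vector select the factor writes the integrand as a product
    over \<open>Basis\<close>. Since \<open>lborel\<close> is the image of a product measure over
    \<open>Basis\<close>, Fubini then applies.\<close>
  define F where "F b t = indicator {0..1} t * (if b = (axis 1 1 :: real ^ 2) then f t else g t)" for b t
  have int: "integrable lborel (F b)" for b
    using assms unfolding F_def set_integrable_def by (cases "b = axis 1 1") auto
  have meas [measurable]: "F b \<in> borel_measurable borel" for b
    using borel_measurable_integrable[OF int, of b] by simp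
  have eq: "indicator unit_square x *\<^sub>R (f (x $ 1) * g (x $ 2)) = (\<Prod>b\<in>Basis. F b (x \<bullet> b))" for x
    using axis_1_neq_2
    by (simp add: Basis_real_2 F_def inner_axis unit_square_def forall_2 indicator_def)
  have "(LINT x:unit_square|lborel. f (x $ 1) * g (x $ 2)) =
      (\<integral>x. (\<Prod>b\<in>Basis. F b (x \<bullet> b)) \<partial>lborel)"
    unfolding set_lebesgue_integral_def eq ..
  also have "\<dots> = (\<integral>h. (\<Prod>b\<in>Basis. F b ((\<Sum>c\<in>Basis. h c *\<^sub>R c) \<bullet> b)) \<partial>(\<Pi>\<^sub>M b\<in>Basis. lborel))"
    by (subst lborel_eq, subst integral_distr) simp_all
  also have "\<dots> = (\<integral>h. (\<Prod>b\<in>Basis. F b (h b)) \<partial>(\<Pi>\<^sub>M b\<in>Basis. lborel))"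
    by (intro Bochner_Integration.integral_cong prod.cong) (auto simp: inner_sum_left inner_Basis if_distrib sum.If_cases cong: if_cong)
  also have "\<dots> = (\<Prod>b\<in>Basis. \<integral>t. F b t \<partial>lborel)"
    by (rule product_integral_prod) (simp_all add: int)
  also have "\<dots> = (LINT x:{0..1}|lborel. f x) * (LINT x:{0..1}|lborel. g x)"
    using axis_1_neq_2 by (auto simp: Basis_real_2 F_def set_lebesgue_integral_def)
  finally show ?thesis .
qed

lemma set_integral_sum:
  fixes f :: "'i \<Rightarrow> 'a \<Rightarrow> real"
  assumes "\<And>i. i \<in> I \<Longrightarrow> set_integrable M A (f i)"
  shows "(LINT x:A|M. \<Sum>i\<in>I. f i x) = (\<Sum>i\<in>I. LINT x:A|M. f i x)"
  using assms unfolding set_lebesgue_integral_def set_integrable_def scaleR_sum_right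
  by (rule Bochner_Integration.integral_sum)

lemma set_integrable_borel_subset_unit_square:
  fixes f :: "real ^ 2 \<Rightarrow> real"
  assumes "A \<in> sets borel" "A \<subseteq> unit_square" "continuous_on unit_square f"
  shows "set_integrable lborel A f"
proof (rule set_integrable_subset)
  show "set_integrable lborel unit_square f"
    unfolding set_integrable_def using compact_unit_square assms(3) by (rule borel_integrable_compact)
qed (use assms in simp_all)

text \<open>Dominated convergence, with the absolute value of \<open>f\<close> on the square as
  majorant. Eventual agreement of membership at almost every point is the mode of set convergence
  used throughout, as it passes to moments and to the Nikodym distance alike.\<close>

lemma set_integral_tendsto:
  fixes f :: "real ^ 2 \<Rightarrow> real"
  assumes A: "\<And>j. A j \<in> sets borel" "\<And>j. A j \<subseteq> unit_square"
    and B: "B \<in> sets borel" "B \<subseteq> unit_square"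
    and conv: "AE x in lborel. \<forall>\<^sub>F j in sequentially. x \<in> A j \<longleftrightarrow> x \<in> B"
    and f: "continuous_on unit_square f"
  shows "(\<lambda>j. LINT x:A j|lborel. f x) \<longlonglongrightarrow> (LINT x:B|lborel. f x)"
  unfolding set_lebesgue_integral_def
proof (rule integral_dominated_convergence[where w = "\<lambda>x. norm (indicator unit_square x *\<^sub>R f x)"])
  show "integrable lborel (\<lambda>x. norm (indicator unit_square x *\<^sub>R f x))"
    using borel_integrable_compact[OF compact_unit_square f] by (rule integrable_norm)
  show "(\<lambda>x. indicat_real B x *\<^sub>R f x) \<in> borel_measurable lborel"
    using set_integrable_borel_subset_unit_square[OF B f] unfolding set_integrable_def by blast
  show "(\<lambda>x. indicat_real (A j) x *\<^sub>R f x) \<in> borel_measurable lborel" for j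
    using set_integrable_borel_subset_unit_square[OF A f] unfolding set_integrable_def by blast
  show "AE x in lborel. (\<lambda>j. indicat_real (A j) x *\<^sub>R f x) \<longlonglongrightarrow> indicat_real B x *\<^sub>R f x"
    using conv
  proof eventually_elim
    case (elim x)
    then show ?case
      by (intro tendsto_eventually) (auto elim!: eventually_mono simp: indicator_def)
  qed
  show "AE x in lborel. norm (indicat_real (A j) x *\<^sub>R f x) \<le> norm (indicator unit_square x *\<^sub>R f x)" for j
    using A(2)[of j] by (intro AE_I2) (auto simp: indicator_def)
qed

lemma continuous_on_legendre_prod:
  "continuous_on S (\<lambda>x::real ^ 2. poly p (x $ 1) * poly q (x $ 2))"
  by (intro continuous_intros)

lemma legendre_moment_tendsto:
  assumes "\<And>j. A j \<in> sets borel" "\<And>j. A j \<subseteq> unit_square" "B \<in> sets borel" "B \<subseteq> unit_square"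
    and "AE x in lborel. \<forall>\<^sub>F j in sequentially. x \<in> A j \<longleftrightarrow> x \<in> B"
  shows "(\<lambda>j. legendre_moment k l (A j)) \<longlonglongrightarrow> legendre_moment k l B"
  unfolding legendre_moment_def using assms continuous_on_legendre_prod by (rule set_integral_tendsto)

lemma nikodym_dist_eq_set_integral: "nikodym_dist A B = (LINT x:sym_diff A B|lborel. 1)"
  if "A \<in> sets borel" "B \<in> sets borel"
  using that by (simp add: nikodym_dist_def set_lebesgue_integral_def)

lemma nikodym_dist_tendsto:
  assumes A: "\<And>j. A j \<in> sets borel" "\<And>j. A j \<subseteq> unit_square" and B: "B \<in> sets borel" "B \<subseteq> unit_square"
    and conv: "AE x in lborel. \<forall>\<^sub>F j in sequentially. x \<in> A j \<longleftrightarrow> x \<in> B"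
    and K: "K \<in> sets borel" "K \<subseteq> unit_square"
  shows "(\<lambda>j. nikodym_dist K (A j)) \<longlonglongrightarrow> nikodym_dist K B"
proof -
  have "(\<lambda>j. LINT x:sym_diff K (A j)|lborel. (1::real)) \<longlonglongrightarrow> (LINT x:sym_diff K B|lborel. 1)"
  proof (rule set_integral_tendsto)
    show "AE x in lborel. \<forall>\<^sub>F j in sequentially. x \<in> sym_diff K (A j) \<longleftrightarrow> x \<in> sym_diff K B"
      using conv by eventually_elim (erule eventually_mono, blast)
    show "sym_diff K (A j) \<in> sets borel" "sym_diff K (A j) \<subseteq> unit_square" for j
      using A[of j] K by auto
    show "sym_diff K B \<in> sets borel" "sym_diff K B \<subseteq> unit_square"
      using B K by auto
  qed (rule continuous_on_const)
  then show ?thesis using A B K by (simp add: nikodym_dist_eq_set_integral)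
qed

lemma measure_unit_square: "measure lborel unit_square = 1"
proof -
  have "(\<Prod>b\<in>Basis. (1 - 0 :: real ^ 2) \<bullet> b) = 1"
    using axis_1_neq_2 by (simp add: Basis_real_2 inner_axis)
  then show ?thesis
    unfolding unit_square_eq_cbox
    by (subst measure_lborel_cbox_eq) (auto simp: Basis_real_2 inner_axis)
qed

lemma nikodym_dist_le_1:
  assumes "A \<in> sets borel" "B \<in> sets borel" "A \<subseteq> unit_square" "B \<subseteq> unit_square"
  shows "nikodym_dist A B \<le> 1"
proof -
  have "unit_square \<in> fmeasurable lborel"
    using compact_unit_square by (rule fmeasurable_compact)
  then have "measure lborel (sym_diff A B) \<le> measure lborel unit_square"
    by (intro measure_mono_fmeasurable) (use assms in auto)
  then show ?thesis by (simp add: nikodym_dist_def measure_unit_square)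
qed

lemma nikodym_dist_nonneg: "0 \<le> nikodym_dist A B"
  by (simp add: nikodym_dist_def)

text \<open>The difference \<open>g\<close> of the indicators has square integral equal to the area
  of the symmetric difference, and \<open>p\<close> is its projection onto the products of Legendre
  polynomials up to order \<open>N\<close>. Both the integral of \<open>g * p\<close> and that of
  \<open>p * p\<close> equal the sum of squared coefficients, so the claim is nonnegativity of the
  integral of the square of \<open>g - p\<close>.\<close>

lemma bessel_legendre_moment:
  assumes A: "A \<in> sets borel" "A \<subseteq> unit_square" and B: "B \<in> sets borel" "B \<subseteq> unit_square"
  shows "(\<Sum>k\<le>N. \<Sum>l\<le>N. (legendre_moment k l A - legendre_moment k l B)\<^sup>2) \<le> nikodym_dist A B"
proof -
  define I where "I = {..N} \<times> {..N}"
  define e where "e i x = poly (legendre (fst i)) (x $ 1) * poly (legendre (snd i)) (x $ 2)"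
    for i and x :: "real ^ 2"
  define g :: "real ^ 2 \<Rightarrow> real" where "g x = indicator A x - indicator B x" for x
  define a where "a i = legendre_moment (fst i) (snd i) A - legendre_moment (fst i) (snd i) B" for i
  define J where "J f = (LINT x:unit_square|lborel. f x)" for f :: "real ^ 2 \<Rightarrow> real"
  define p where "p x = (\<Sum>i\<in>I. a i * e i x)" for x
  have cont_e [continuous_intros]: "continuous_on unit_square (e i)" for i
    unfolding e_def by (intro continuous_on_legendre_prod)
  have cont_p [continuous_intros]: "continuous_on unit_square p"
    unfolding p_def by (intro continuous_intros)
  have int_cont: "set_integrable lborel unit_square f" if "continuous_on unit_square f" for f :: "real ^ 2 \<Rightarrow> real"
    using that by (intro set_integrable_borel_subset_unit_square) auto
  have ind: "(\<lambda>x. indicator unit_square x *\<^sub>R (g x * f x)) =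
      (\<lambda>x. indicator A x *\<^sub>R f x - indicator B x *\<^sub>R f x)" for f :: "real ^ 2 \<Rightarrow> real"
    using A(2) B(2) by (auto simp: fun_eq_iff g_def indicator_def)
  have int_g: "set_integrable lborel unit_square (\<lambda>x. g x * f x)"
    and J_g: "J (\<lambda>x. g x * f x) = (LINT x:A|lborel. f x) - (LINT x:B|lborel. f x)"
    if "continuous_on unit_square f" for f
    using set_integrable_borel_subset_unit_square[OF A that] set_integrable_borel_subset_unit_square[OF B that]
    unfolding J_def set_integrable_def set_lebesgue_integral_def ind by simp_all
  have g2: "indicator unit_square x *\<^sub>R (g x * g x) = indicator (sym_diff A B) x *\<^sub>R 1" for x
    using A(2) B(2) by (auto simp: g_def indicator_def)
  have J_g2: "J (\<lambda>x. g x * g x) = nikodym_dist A B"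
    unfolding J_def set_lebesgue_integral_def g2 using A B by (simp add: nikodym_dist_def)
  have int_g2: "set_integrable lborel unit_square (\<lambda>x. g x * g x)"
    using set_integrable_borel_subset_unit_square[of "sym_diff A B" "\<lambda>_. 1"] A B
    unfolding set_integrable_def g2 by auto
  have J_e: "J (\<lambda>x. e i x * e j x) = (if i = j then 1 else 0)" for i j
  proof -
    obtain k l k' l' where ij: "i = (k, l)" "j = (k', l')" by (cases i, cases j)
    have int: "set_integrable lborel {0..1} (\<lambda>x. poly q x * poly r x)" for q r :: "real poly"
      using set_integrable_poly[of "q * r"] by simp
    have "J (\<lambda>x. e i x * e j x) = inner_L2 (legendre k) (legendre k') * inner_L2 (legendre l) (legendre l')"
      using set_integral_unit_square_prod[OF int int, of "legendre k" "legendre k'" "legendre l" "legendre l'"]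
      by (simp add: J_def ij e_def inner_L2_def mult_ac)
    then show ?thesis by (simp add: inner_L2_legendre ij)
  qed
  have J_sum: "J (\<lambda>x. \<Sum>i\<in>I. a i * f i x) = (\<Sum>i\<in>I. a i * J (f i))"
    if "\<And>i. set_integrable lborel unit_square (f i)" for f
    unfolding J_def using that by (subst set_integral_sum) auto
  have J_ge: "J (\<lambda>x. g x * e i x) = a i" for i
    using J_g[OF cont_e, of i] by (cases i) (simp add: a_def legendre_moment_def e_def)
  have J_pe: "J (\<lambda>x. e i x * p x) = a i" if "i \<in> I" for i
  proof -
    have "J (\<lambda>x. e i x * p x) = J (\<lambda>x. \<Sum>j\<in>I. a j * (e i x * e j x))"
      by (simp add: p_def sum_distrib_left mult_ac)
    also have "\<dots> = (\<Sum>j\<in>I. a j * (if i = j then 1 else 0))"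
      by (subst J_sum) (auto intro!: int_cont continuous_intros simp: J_e)
    finally show ?thesis using that by (simp add: I_def if_distrib cong: if_cong)
  qed
  have J_gp: "J (\<lambda>x. g x * p x) = (\<Sum>i\<in>I. (a i)\<^sup>2)"
  proof -
    have "J (\<lambda>x. g x * p x) = J (\<lambda>x. \<Sum>j\<in>I. a j * (g x * e j x))"
      by (simp add: p_def sum_distrib_left mult_ac)
    also have "\<dots> = (\<Sum>j\<in>I. a j * a j)"
      by (subst J_sum) (auto intro!: int_g continuous_intros simp: J_ge)
    finally show ?thesis by (simp add: power2_eq_square)
  qed
  have J_pp: "J (\<lambda>x. p x * p x) = (\<Sum>i\<in>I. (a i)\<^sup>2)"
  proof -
    have "p x * p x = (\<Sum>j\<in>I. a j * (e j x * p x))" for x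
      unfolding p_def[of x] by (simp add: sum_distrib_right mult_ac)
    then have "J (\<lambda>x. p x * p x) = J (\<lambda>x. \<Sum>j\<in>I. a j * (e j x * p x))"
      by simp
    also have "\<dots> = (\<Sum>j\<in>I. a j * a j)"
      by (subst J_sum) (auto intro!: int_cont continuous_intros simp: J_pe)
    finally show ?thesis by (simp add: power2_eq_square)
  qed
  have "0 \<le> J (\<lambda>x. (g x - p x)\<^sup>2)"
    unfolding J_def set_lebesgue_integral_def by (intro integral_nonneg_AE) auto
  also have "J (\<lambda>x. (g x - p x)\<^sup>2) = J (\<lambda>x. (g x * g x + p x * p x) - 2 * (g x * p x))"
    by (simp add: power2_eq_square algebra_simps)
  also have "\<dots> = J (\<lambda>x. g x * g x) + J (\<lambda>x. p x * p x) - 2 * J (\<lambda>x. g x * p x)"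
    unfolding J_def using int_g2 int_cont[of "\<lambda>x. p x * p x"] int_g[of p] cont_p
    by (simp add: set_integral_diff(2) set_integral_add(2) set_integral_add(1) continuous_on_mult)
  also have "\<dots> = nikodym_dist A B - (\<Sum>i\<in>I. (a i)\<^sup>2)"
    by (simp add: J_g2 J_gp J_pp)
  finally show ?thesis
    by (simp add: I_def a_def sum.cartesian_product split_def)
qed

section \<open>Compact subsets of the square are determined by their moments up to null sets\<close>

lemma moments_eq_imp_integral_poly_eq:
  assumes A: "A \<in> sets borel" "A \<subseteq> unit_square" and B: "B \<in> sets borel" "B \<subseteq> unit_square"
    and eq: "\<And>k l. legendre_moment k l A = legendre_moment k l B"
  shows "(LINT x:A|lborel. poly p (x $ 1) * poly q (x $ 2)) =
         (LINT x:B|lborel. poly p (x $ 1) * poly q (x $ 2))"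
proof -
  define D where "D p q = (LINT x:A|lborel. poly p (x $ 1) * poly q (x $ 2)) -
    (LINT x:B|lborel. poly p (x $ 1) * poly q (x $ 2))" for p q
  have add: "D (p + p') q = D p q + D p' q" "D p (q + q') = D p q + D p q'" for p p' q q'
  proof -
    note int = set_integrable_borel_subset_unit_square[OF _ _ continuous_on_legendre_prod]
    have "(LINT x:C|lborel. poly (p + p') (x $ 1) * poly q (x $ 2)) =
        (LINT x:C|lborel. poly p (x $ 1) * poly q (x $ 2)) + (LINT x:C|lborel. poly p' (x $ 1) * poly q (x $ 2))"
      "(LINT x:C|lborel. poly p (x $ 1) * poly (q + q') (x $ 2)) =
        (LINT x:C|lborel. poly p (x $ 1) * poly q (x $ 2)) + (LINT x:C|lborel. poly p (x $ 1) * poly q' (x $ 2))"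
      if "C \<in> sets borel" "C \<subseteq> unit_square" for C
      using int[OF that, of p q] int[OF that, of p' q] int[OF that, of p q']
      by (simp_all add: distrib_left distrib_right set_integral_add(2))
    with A B show "D (p + p') q = D p q + D p' q" "D p (q + q') = D p q + D p q'"
      unfolding D_def by simp_all
  qed
  have smult: "D (smult c p) q = c * D p q" "D p (smult c q) = c * D p q" for c p q
  proof -
    have "poly (smult c p) s * poly q t = c * (poly p s * poly q t)"
      "poly p s * poly (smult c q) t = c * (poly p s * poly q t)" for s t
      by simp_all
    then show "D (smult c p) q = c * D p q" "D p (smult c q) = c * D p q"
      unfolding D_def by (simp_all only: set_integral_mult_right right_diff_distrib)
  qed
  have "D (legendre k) (legendre l) = 0" for k l
    using eq[of k l] by (simp add: D_def legendre_moment_def)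
  then have "D p (legendre l) = 0" for p l
    by (rule poly_linear_vanish[where \<Phi> = "\<lambda>p. D p (legendre l)", OF add(1) smult(1)])
  then have "D p q = 0" for p q
    by (rule poly_linear_vanish[where \<Phi> = "D p", OF add(2) smult(2)])
  then show ?thesis by (simp add: D_def)
qed

text \<open>Bivariate polynomials are elements \<open>p\<close> of \<^typ>\<open>real poly poly\<close>, evaluated by
  substituting the second variable last.\<close>

lemma real_polynomial_function_eq_poly2:
  fixes f :: "real ^ 2 \<Rightarrow> real"
  assumes "real_polynomial_function f"
  obtains p :: "real poly poly" where "\<And>x. f x = poly (poly p [:x $ 1:]) (x $ 2)"
proof -
  have "\<exists>p :: real poly poly. \<forall>x. f x = poly (poly p [:x $ 1:]) (x $ 2)"
    using assms
  proof induction
    case (linear f)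
    interpret bounded_linear f by fact
    have "f x = x $ 1 * f (axis 1 1) + x $ 2 * f (axis 2 1)" for x
    proof -
      have "x = x $ 1 *\<^sub>R axis 1 1 + x $ 2 *\<^sub>R axis 2 1"
        by (simp add: vec_eq_iff forall_2 axis_def)
      then show ?thesis by (metis add scaleR real_scaleR_def)
    qed
    moreover have "poly (poly [:[:0, b:], [:a:]:] [:s:]) t = s * a + t * b" for a b s t :: real
      by simp
    ultimately show ?case by metis
  next
    case (const c)
    then show ?case by (intro exI[of _ "[:[:c:]:]"]) simp
  next
    case (add f g)
    then show ?case by (metis poly_add)
  next
    case (mult f g)
    then show ?case by (metis poly_mult)
  qed
  then show ?thesis using that by blast
qed

lemma moments_eq_imp_integral_continuous_eq:
  fixes f :: "real ^ 2 \<Rightarrow> real"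
  assumes A: "A \<in> sets borel" "A \<subseteq> unit_square" and B: "B \<in> sets borel" "B \<subseteq> unit_square"
    and eq: "\<And>k l. legendre_moment k l A = legendre_moment k l B"
    and f: "continuous_on unit_square f"
  shows "(LINT x:A|lborel. f x) = (LINT x:B|lborel. f x)"
proof -
  have poly: "(LINT x:A|lborel. g x) = (LINT x:B|lborel. g x)" if g: "real_polynomial_function g" for g
  proof -
    obtain p where p: "\<And>x. g x = poly (poly p [:x $ 1:]) (x $ 2)"
      using real_polynomial_function_eq_poly2[OF g] by blast
    \<comment> \<open>Expanding in the outer variable separates \<open>g\<close> into powers of the
      first coordinate times polynomials in the second, the form whose integrals the moments
      control.\<close>
    have g_eq: "g x = (\<Sum>i\<le>degree p. poly (monom 1 i) (x $ 1) * poly (coeff p i) (x $ 2))" for x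
      by (simp add: p poly_altdef[of p] poly_sum poly_monom poly_power mult.commute)
    have "(LINT x:C|lborel. g x) =
        (\<Sum>i\<le>degree p. LINT x:C|lborel. poly (monom 1 i) (x $ 1) * poly (coeff p i) (x $ 2))"
      if "C \<in> sets borel" "C \<subseteq> unit_square" for C
      unfolding g_eq
      by (rule set_integral_sum) (rule set_integrable_borel_subset_unit_square[OF that continuous_on_legendre_prod])
    then show ?thesis
      using A B moments_eq_imp_integral_poly_eq[OF A B eq] by simp
  qed
  have close: "\<bar>(LINT x:C|lborel. f x) - (LINT x:C|lborel. g x)\<bar> \<le> e"
    if C: "C \<in> sets borel" "C \<subseteq> unit_square" and g: "continuous_on unit_square g"
      and e: "\<And>x. x \<in> unit_square \<Longrightarrow> \<bar>f x - g x\<bar> < e" "e > 0" for C g e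
  proof -
    have "(LINT x:C|lborel. f x) - (LINT x:C|lborel. g x) = (LINT x:C|lborel. f x - g x)"
      using set_integrable_borel_subset_unit_square[OF C f] set_integrable_borel_subset_unit_square[OF C g]
      by (rule set_integral_diff(2)[symmetric])
    also have "\<bar>\<dots>\<bar> \<le> (\<integral>x. indicator unit_square x * e \<partial>lborel)"
      unfolding set_lebesgue_integral_def real_norm_def[symmetric]
    proof (rule Bochner_Integration.integral_norm_bound_integral)
      show "integrable lborel (\<lambda>x. indicator C x *\<^sub>R (f x - g x))"
        using set_integrable_borel_subset_unit_square[OF C continuous_on_diff[OF f g]]
        unfolding set_integrable_def .
      show "integrable lborel (\<lambda>x::real ^ 2. indicator unit_square x * e)"
        using borel_integrable_compact[OF compact_unit_square continuous_on_const[of _ e]] by simp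
      show "norm (indicator C x *\<^sub>R (f x - g x)) \<le> indicator unit_square x * e" for x
        using C(2) e(1)[of x] \<open>e > 0\<close> by (auto simp: indicator_def)
    qed
    also have "\<dots> = e"
      by (simp add: measure_unit_square)
    finally show ?thesis .
  qed
  show ?thesis
  proof (rule ccontr)
    assume ne: "\<not> ?thesis"
    \<comment> \<open>Each of the two integrals moves by at most \<open>e\<close>, as the square has
      area 1. A gap of \<open>3 * e\<close> cannot be closed by two such errors.\<close>
    define e where "e = \<bar>(LINT x:A|lborel. f x) - (LINT x:B|lborel. f x)\<bar> / 3"
    have "e > 0" using ne by (simp add: e_def)
    obtain g where g: "real_polynomial_function g" "\<And>x. x \<in> unit_square \<Longrightarrow> \<bar>f x - g x\<bar> < e"
      using Stone_Weierstrass_real_polynomial_function[OF compact_unit_square f \<open>e > 0\<close>] by blast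
    have cont: "continuous_on unit_square g"
      using g(1) continuous_on_polymonial_function real_polynomial_function_eq by blast
    have "\<bar>(LINT x:A|lborel. f x) - (LINT x:A|lborel. g x)\<bar> \<le> e"
      "\<bar>(LINT x:B|lborel. f x) - (LINT x:B|lborel. g x)\<bar> \<le> e"
      using g(2) \<open>e > 0\<close> by (auto intro!: close A B cont)
    then have "\<bar>(LINT x:A|lborel. f x) - (LINT x:B|lborel. f x)\<bar> \<le> e + e"
      using poly[OF g(1)] by linarith
    then have "3 * e \<le> e + e" by (simp add: e_def)
    then show False using \<open>e > 0\<close> by simp
  qed
qed

text \<open>The continuous functions \<open>f n\<close> equal 1 on \<open>A\<close> and decrease to
  its indicator, because points off the closed set \<open>A\<close> have positive distance from it.
  Their integrals over \<open>A\<close> and \<open>B\<close> agree; the former are the area of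
  \<open>A\<close>, the latter tend to the area of the intersection.\<close>

lemma moments_eq_imp_measure_Int_eq:
  assumes A: "compact A" "A \<subseteq> unit_square" and B: "compact B" "B \<subseteq> unit_square"
    and eq: "\<And>k l. legendre_moment k l A = legendre_moment k l B"
  shows "measure lborel A = measure lborel (A \<inter> B)"
\<comment> \<open>The empty set is split off because \<open>infdist\<close> to it is 0 by
  convention, which would make every \<open>f n\<close> constantly 1.\<close>
proof (cases "A = {}")
  case False
  have bA: "A \<in> sets borel" and bB: "B \<in> sets borel"
    using A B by (auto intro: borel_compact)
  define f where "f n x = max 0 (1 - real n * infdist x A)" for n x
  have cont: "continuous_on S (f n)" for n S
    unfolding f_def by (intro continuous_intros)
  have int: "set_integrable lborel B (f n)" for n
    using bB B(2) cont by (rule set_integrable_borel_subset_unit_square)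
  have "(\<lambda>n. LINT x:B|lborel. f n x) \<longlonglongrightarrow> (\<integral>x. indicator (A \<inter> B) x \<partial>lborel)"
    unfolding set_lebesgue_integral_def
  proof (rule integral_dominated_convergence[where w = "indicator B"])
    show "indicator (A \<inter> B) \<in> borel_measurable lborel" using bA bB by simp
    show "(\<lambda>x. indicator B x *\<^sub>R f n x) \<in> borel_measurable lborel" for n
      using int unfolding set_integrable_def by blast
    show "integrable lborel (indicator B :: real ^ 2 \<Rightarrow> real)"
      using set_integrable_borel_subset_unit_square[OF bB B(2) continuous_on_const[of _ 1]]
      by (simp add: set_integrable_def)
    show "AE x in lborel. norm (indicator B x *\<^sub>R f n x) \<le> indicator B x" for n
      by (auto simp: f_def indicator_def infdist_nonneg)
    show "AE x in lborel. (\<lambda>n. indicator B x *\<^sub>R f n x) \<longlonglongrightarrow> indicator (A \<inter> B) x"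
    proof (intro AE_I2)
      fix x
      show "(\<lambda>n. indicator B x *\<^sub>R f n x) \<longlonglongrightarrow> indicator (A \<inter> B) x"
      proof (cases "x \<in> A")
        case True
        then show ?thesis by (simp add: f_def indicator_def)
      next
        case x: False
        then have "infdist x A > 0"
          using A(1) False compact_imp_closed infdist_pos_not_in_closed by blast
        then obtain n0 where "real n0 * infdist x A > 1" using reals_Archimedean3 by blast
        then have "f n x = 0" if "n \<ge> n0" for n
          using that mult_right_mono[of "real n0" "real n" "infdist x A"]
          by (simp add: f_def infdist_nonneg)
        then show ?thesis
          using x by (intro tendsto_eventually eventually_sequentiallyI[of n0]) (simp add: indicator_def)
      qed
    qed
  qed
  moreover have "(LINT x:B|lborel. f n x) = measure lborel A" for n
  proof -
    have "(LINT x:B|lborel. f n x) = (LINT x:A|lborel. f n x)"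
      using moments_eq_imp_integral_continuous_eq[OF bA A(2) bB B(2) eq cont] by simp
    also have "\<dots> = (LINT x:A|lborel. 1)"
      using bA by (intro set_lebesgue_integral_cong) (auto simp: f_def)
    finally show ?thesis using bA by (simp add: set_lebesgue_integral_def)
  qed
  ultimately show ?thesis
    using bA bB LIMSEQ_unique[OF tendsto_const[of "measure lborel A" sequentially]] by simp
qed simp

lemma moments_eq_imp_nikodym_dist_0:
  assumes A: "compact A" "A \<subseteq> unit_square" and B: "compact B" "B \<subseteq> unit_square"
    and eq: "\<And>k l. legendre_moment k l A = legendre_moment k l B"
  shows "nikodym_dist A B = 0"
proof -
  have fm: "A \<in> fmeasurable lborel" "B \<in> fmeasurable lborel"
    using A B by (auto intro: fmeasurable_compact)
  have "measure lborel (A - B) = measure lborel A - measure lborel (A \<inter> B)"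
    "measure lborel (B - A) = measure lborel B - measure lborel (B \<inter> A)"
    using fm measurable_measure_Diff[of A lborel "A \<inter> B"] measurable_measure_Diff[of B lborel "B \<inter> A"]
    by (auto simp: Diff_Int fmeasurableD)
  then have "measure lborel (A - B) = 0" "measure lborel (B - A) = 0"
    using moments_eq_imp_measure_Int_eq[OF A B eq] moments_eq_imp_measure_Int_eq[OF B A eq[symmetric]]
    by simp_all
  then show ?thesis
    unfolding nikodym_dist_def using measure_Un_le[of "A - B" lborel "B - A"] fm[THEN fmeasurableD]
    by (simp add: antisym)
qed

section \<open>Selection and stability\<close>

text \<open>The 1-norm gives this crude bound; the constant reappears as the Lipschitz constant of
  support functions.\<close>

lemma norm_unit_square_le: "norm x \<le> 2" if "x \<in> unit_square"
  using that norm_le_l1_cart[of x] by (simp add: unit_square_def sum_2 forall_2)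

lemma inner_le_support_fun:
  assumes "compact K" "x \<in> K"
  shows "x \<bullet> v \<le> support_fun K v"
proof -
  have "compact ((\<lambda>x. x \<bullet> v) ` K)"
    using assms(1) by (intro compact_continuous_image continuous_intros)
  then show ?thesis
    unfolding support_fun_def using assms(2)
    by (intro cSUP_upper) (auto intro: bounded_imp_bdd_above compact_imp_bounded)
qed

lemma support_fun_attained:
  assumes "compact K" "K \<noteq> {}"
  obtains x where "x \<in> K" "x \<bullet> v = support_fun K v"
proof -
  have "continuous_on K (\<lambda>x. x \<bullet> v)" by (intro continuous_intros)
  then obtain x where x: "x \<in> K" "\<forall>y\<in>K. y \<bullet> v \<le> x \<bullet> v"
    using continuous_attains_sup[OF assms] by blast
  have "support_fun K v \<le> x \<bullet> v"
    unfolding support_fun_def using x assms by (intro cSUP_least) auto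
  with inner_le_support_fun[OF assms(1) x(1), of v] x(1) that show ?thesis by force
qed

text \<open>The Lipschitz constant is the same for all sets \<open>K\<close>. This equicontinuity is
  what carries information from a dense set of directions to every direction.\<close>

lemma support_fun_le_add:
  assumes "compact K" "K \<noteq> {}" "K \<subseteq> unit_square"
  shows "support_fun K v \<le> support_fun K w + 2 * norm (v - w)"
proof -
  obtain x where x: "x \<in> K" "x \<bullet> v = support_fun K v"
    using support_fun_attained[OF assms(1,2)] .
  have "x \<bullet> v = x \<bullet> w + x \<bullet> (v - w)" by (simp add: inner_diff_right)
  moreover have "x \<bullet> (v - w) \<le> norm x * norm (v - w)" by (rule norm_cauchy_schwarz)
  moreover have "norm x * norm (v - w) \<le> 2 * norm (v - w)"
    using norm_unit_square_le x(1) assms(3) by (intro mult_right_mono) auto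
  ultimately show ?thesis
    using inner_le_support_fun[OF assms(1) x(1), of w] x(2) by linarith
qed

lemma abs_support_fun_le:
  assumes "compact K" "K \<noteq> {}" "K \<subseteq> unit_square"
  shows "\<bar>support_fun K v\<bar> \<le> 2 * norm v"
proof -
  have "support_fun K 0 = 0"
    using support_fun_attained[OF assms(1,2), of 0] by (metis inner_zero_right)
  then show ?thesis
    using support_fun_le_add[OF assms, of v 0] support_fun_le_add[OF assms, of 0 v] by simp
qed

lemma support_fun_separation:
  assumes "compact K" "convex K" "K \<noteq> {}" "x \<notin> K"
  obtains v where "norm v = 1" "support_fun K v < x \<bullet> v"
proof -
  obtain a b where ab: "a \<bullet> x < b" "\<forall>y\<in>K. b < a \<bullet> y"
    using separating_hyperplane_closed_point[of K x] assms compact_imp_closed by blast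
  have "a \<noteq> 0" using ab assms(3) by fastforce
  define v where "v = - a /\<^sub>R norm a"
  obtain y where y: "y \<in> K" "y \<bullet> v = support_fun K v"
    using support_fun_attained[OF assms(1,3)] .
  have "a \<bullet> x < a \<bullet> y" using ab y(1) by fastforce
  then have "y \<bullet> v < x \<bullet> v"
    using \<open>a \<noteq> 0\<close> by (simp add: v_def inner_commute field_simps)
  moreover have "norm v = 1" using \<open>a \<noteq> 0\<close> by (simp add: v_def)
  ultimately show ?thesis using that y(2) by metis
qed

lemma compact_PiE_UNIV:
  fixes S :: "'i \<Rightarrow> 'b::topological_space set"
  assumes "\<And>i. compact (S i)"
  shows "compact (PiE UNIV S)"
  using assms by (simp add: compactin_PiE flip: compactin_euclidean_iff euclidean_product_topology)

lemma tendsto_fun_component: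
  fixes f :: "nat \<Rightarrow> 'i \<Rightarrow> 'b::topological_space"
  assumes "f \<longlonglongrightarrow> l"
  shows "(\<lambda>n. f n i) \<longlonglongrightarrow> l i"
  using continuous_on_tendsto_compose[OF continuous_on_product_coordinates[of i] assms] by simp

lemma AE_not_in_frontier_convex: "AE x in lborel. x \<notin> frontier S" if "convex S" for S :: "'a::euclidean_space set"
proof -
  have "frontier S \<in> null_sets lborel"
    using negligible_convex_frontier[OF that]
    by (simp add: negligible_iff_null_sets null_sets_completion_iff)
  then show ?thesis by (rule AE_not_in)
qed

text \<open>A form of Blaschke's selection theorem: the support functions converge on a countable
  dense set of directions along a subsequence, and their limits cut out the limit set.\<close>

lemma convex_selection:
  fixes P :: "nat \<Rightarrow> (real ^ 2) set"
  assumes P: "\<And>j. compact (P j)" "\<And>j. convex (P j)" "\<And>j. P j \<noteq> {}" "\<And>j. P j \<subseteq> unit_square"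
  obtains r B where "strict_mono (r :: nat \<Rightarrow> nat)" "compact B" "B \<subseteq> unit_square"
    "AE x in lborel. \<forall>\<^sub>F j in sequentially. x \<in> P (r j) \<longleftrightarrow> x \<in> B"
proof -
  obtain D :: "(real ^ 2) set" where D: "countable D" "\<And>X. open X \<Longrightarrow> X \<noteq> {} \<Longrightarrow> \<exists>d\<in>D. d \<in> X"
    using countable_dense_exists by metis
  have "D \<noteq> {}" using D(2)[of UNIV] by auto
  define d where "d = from_nat_into D"
  have d: "\<exists>i. d i \<in> X" if "open X" "X \<noteq> {}" for X
    using D(2)[OF that] from_nat_into_surj[OF D(1)] unfolding d_def by metis
  define H where "H j i = support_fun (P j) (d i)" for j i
  define S where "S i = {- 2 * norm (d i) .. 2 * norm (d i)}" for i
  have "compact (PiE UNIV S)"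
    by (rule compact_PiE_UNIV) (simp add: S_def)
  moreover have "\<forall>j. H j \<in> PiE UNIV S"
    using abs_support_fun_le[OF P(1,3,4)] by (auto simp: H_def S_def abs_le_iff minus_le_iff)
  ultimately obtain l r where r: "strict_mono (r :: nat \<Rightarrow> nat)" and lim: "(H \<circ> r) \<longlonglongrightarrow> l"
    unfolding compact_def by blast
  have lim_i: "(\<lambda>j. support_fun (P (r j)) (d i)) \<longlonglongrightarrow> l i" for i
    using tendsto_fun_component[OF lim, of i] by (simp add: H_def)
  define Q where "Q = {x. \<forall>i. x \<bullet> d i \<le> l i}"
  have Q_eq: "Q = (\<Inter>i. {x. d i \<bullet> x \<le> l i})"
    by (auto simp: Q_def inner_commute)
  have "closed Q" "convex Q"
    unfolding Q_eq by (auto intro!: closed_INT convex_INT closed_halfspace_le convex_halfspace_le)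
  \<comment> \<open>Frontier points of \<open>Q\<close> may move in and out of the sets forever, but
    the frontier of a convex set is null.\<close>
  have "\<forall>\<^sub>F j in sequentially. x \<in> P (r j) \<longleftrightarrow> x \<in> Q \<inter> unit_square" if x: "x \<notin> frontier Q" for x
  proof (cases "x \<in> Q")
    case False
    then obtain i where "x \<bullet> d i > l i" by (auto simp: Q_def not_le)
    then have "\<forall>\<^sub>F j in sequentially. support_fun (P (r j)) (d i) < x \<bullet> d i"
      using lim_i order_tendstoD(2) by blast
    then show ?thesis
    proof eventually_elim
      case (elim j)
      then show ?case using False inner_le_support_fun[OF P(1)] by (meson IntD1 not_le)
    qed
  next
    case True
    then have "x \<in> interior Q" using x \<open>closed Q\<close> by (simp add: frontier_def)
    then obtain \<rho> where \<rho>: "\<rho> > 0" "cball x \<rho> \<subseteq> Q" by (auto simp: mem_interior_cball)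
    \<comment> \<open>At an interior point each constraint has slack: moving from \<open>x\<close>
      by \<open>\<rho>\<close> in direction \<open>d i\<close> does not leave \<open>Q\<close>. For
      \<open>d i = 0\<close> the quotient is 0 and only membership of \<open>x\<close> is
      used.\<close>
    have *: "x \<bullet> d i + \<rho> * norm (d i) \<le> l i" for i
    proof -
      have "x + (\<rho> / norm (d i)) *\<^sub>R d i \<in> Q"
        using \<rho> by (intro subsetD[OF \<rho>(2)]) (auto simp: dist_norm)
      then have "(x + (\<rho> / norm (d i)) *\<^sub>R d i) \<bullet> d i \<le> l i" by (simp add: Q_def)
      then show ?thesis
        by (cases "d i = 0") (simp_all add: inner_add_left dot_square_norm power2_eq_square)
    qed
    \<comment> \<open>Otherwise unit normals \<open>v j\<close> separate \<open>x\<close> from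
      infinitely many of the sets. They accumulate at some \<open>w\<close>, and a dense direction
      close to \<open>w\<close> has too little slack.\<close>
    have "\<forall>\<^sub>F j in sequentially. x \<in> P (r j)"
    proof (rule ccontr)
      assume "\<not> ?thesis"
      then obtain s where s: "strict_mono (s :: nat \<Rightarrow> nat)" "\<And>j. x \<notin> P (r (s j))"
        using not_eventually_sequentiallyD[of "\<lambda>j. x \<in> P (r j)"] by blast
      have "\<exists>v. norm v = 1 \<and> support_fun (P (r (s j))) v < x \<bullet> v" for j
        using support_fun_separation[OF P(1,2,3) s(2)] by metis
      then obtain v where v: "\<And>j. norm (v j) = 1" "\<And>j. support_fun (P (r (s j))) (v j) < x \<bullet> v j"
        by metis
      have "\<forall>j. v j \<in> sphere 0 1" using v(1) by simp
      then obtain w t where w: "w \<in> sphere 0 1" and t: "strict_mono (t :: nat \<Rightarrow> nat)" "(v \<circ> t) \<longlonglongrightarrow> w"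
        using compact_sphere[of "0 :: real ^ 2" 1] unfolding compact_def by blast
      have lim_w: "(\<lambda>j. v (t j)) \<longlonglongrightarrow> w" using t(2) by (simp add: o_def)
      \<comment> \<open>The separating inequality at \<open>v (t j)\<close> is transported to
        \<open>d i\<close> by the Lipschitz bound before the limit is taken, since convergence of
        support values is known only in the directions \<open>d i\<close>.\<close>
      have bound: "l i - 2 * norm (d i - w) \<le> x \<bullet> w" for i
      proof (rule LIMSEQ_le)
        have "(\<lambda>j. support_fun (P (r (s (t j)))) (d i)) \<longlonglongrightarrow> l i"
          using LIMSEQ_subseq_LIMSEQ[OF lim_i[of i] strict_mono_o[OF s(1) t(1)]] by (simp add: o_def)
        then show "(\<lambda>j. support_fun (P (r (s (t j)))) (d i) - 2 * norm (d i - v (t j)))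
            \<longlonglongrightarrow> l i - 2 * norm (d i - w)"
          by (intro tendsto_intros lim_w)
        show "(\<lambda>j. x \<bullet> v (t j)) \<longlonglongrightarrow> x \<bullet> w"
          by (intro tendsto_intros lim_w)
        show "\<exists>N. \<forall>j\<ge>N. support_fun (P (r (s (t j)))) (d i) - 2 * norm (d i - v (t j)) \<le> x \<bullet> v (t j)"
        proof (intro exI allI impI)
          fix j
          show "support_fun (P (r (s (t j)))) (d i) - 2 * norm (d i - v (t j)) \<le> x \<bullet> v (t j)"
            using support_fun_le_add[OF P(1,3,4), of "r (s (t j))" "d i" "v (t j)"] v(2)[of "t j"] by linarith
        qed
      qed
      \<comment> \<open>The factor collects three errors from replacing \<open>w\<close> by
        \<open>d i\<close>: \<open>norm x\<close> from the inner product, \<open>\<rho>\<close> from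
        the norm of \<open>d i\<close>, and 2 from the Lipschitz bound. The additional half produces
        the contradiction \<open>\<rho> < \<rho> / 2\<close>.\<close>
      define \<tau> where "\<tau> = \<rho> / (2 * (norm x + \<rho> + 2))"
      have "norm x + \<rho> + 2 > 0" using \<rho>(1) norm_ge_zero[of x] by linarith
      then have "\<tau> > 0" using \<rho>(1) by (simp add: \<tau>_def)
      then obtain i where i: "norm (d i - w) < \<tau>"
        using d[of "ball w \<tau>"] by (auto simp: dist_norm norm_minus_commute)
      have "x \<bullet> w - x \<bullet> d i \<le> norm x * norm (d i - w)"
        using norm_cauchy_schwarz[of x "w - d i"] by (simp add: inner_diff_right norm_minus_commute)
      moreover have "norm (d i) \<ge> 1 - norm (d i - w)"
        using norm_triangle_ineq2[of w "d i"] w by (simp add: norm_minus_commute)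
      then have "\<rho> * norm (d i) \<ge> \<rho> - \<rho> * norm (d i - w)"
        using \<rho>(1) by (metis (no_types) less_eq_real_def mult.right_neutral mult_left_mono right_diff_distrib)
      ultimately have "\<rho> \<le> (norm x + \<rho> + 2) * norm (d i - w)"
        using bound[of i] *[of i] by (simp add: algebra_simps)
      also have "\<dots> < (norm x + \<rho> + 2) * \<tau>"
        using i \<open>norm x + \<rho> + 2 > 0\<close> by (rule mult_strict_left_mono)
      also have "\<dots> = \<rho> / 2"
        using \<open>norm x + \<rho> + 2 > 0\<close> unfolding \<tau>_def by (simp add: field_simps)
      finally show False using \<rho>(1) by simp
    qed
    then show ?thesis
      by eventually_elim (use True P(4) in auto)
  qed
  with AE_not_in_frontier_convex[OF \<open>convex Q\<close>]
  have "AE x in lborel. \<forall>\<^sub>F j in sequentially. x \<in> P (r j) \<longleftrightarrow> x \<in> Q \<inter> unit_square"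
    by (rule eventually_mono)
  moreover have "compact (Q \<inter> unit_square)"
    using \<open>closed Q\<close> compact_unit_square by (simp add: closed_Int_compact)
  ultimately show ?thesis using r that by blast
qed

lemma convex_stability:
  assumes K: "compact K" "K \<subseteq> unit_square" and "\<eta> > 0"
  obtains \<delta> N\<^sub>0 where "\<delta> > 0" and
    "\<And>N P. \<lbrakk>N \<ge> N\<^sub>0; compact P; convex P; P \<noteq> {}; P \<subseteq> unit_square;
       (\<Sum>k\<le>N. \<Sum>l\<le>N. (legendre_moment k l P - legendre_moment k l K)\<^sup>2) \<le> \<delta>\<rbrakk>
       \<Longrightarrow> nikodym_dist K P \<le> \<eta>"
proof (rule ccontr)
  assume contra: "\<not> thesis"
  \<comment> \<open>\<open>R j\<close> describes a counterexample to the choice of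
    \<open>inverse (real (Suc j))\<close> and \<open>j\<close> as witnesses. If some
    \<open>j\<close> had none, that choice would prove \<open>thesis\<close>.\<close>
  define R where "R j N P \<longleftrightarrow> N \<ge> j \<and> compact P \<and> convex P \<and> P \<noteq> {} \<and> P \<subseteq> unit_square \<and>
      (\<Sum>k\<le>N. \<Sum>l\<le>N. (legendre_moment k l P - legendre_moment k l K)\<^sup>2) \<le> inverse (real (Suc j)) \<and>
      nikodym_dist K P > \<eta>" for j N P
  have "\<exists>N P. R j N P" for j
  proof (rule ccontr)
    assume "\<not> ?thesis"
    then have "thesis"
      by (intro that[of "inverse (real (Suc j))" j]) (auto simp: R_def not_less)
    with contra show False ..
  qed
  then obtain N P where "\<And>j. R j (N j) (P j)"
    by metis
  then have NP: "\<And>j. N j \<ge> j" "\<And>j. compact (P j)" "\<And>j. convex (P j)" "\<And>j. P j \<noteq> {}"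
      "\<And>j. P j \<subseteq> unit_square"
      "\<And>j. (\<Sum>k\<le>N j. \<Sum>l\<le>N j. (legendre_moment k l (P j) - legendre_moment k l K)\<^sup>2)
        \<le> inverse (real (Suc j))"
      "\<And>j. nikodym_dist K (P j) > \<eta>"
    unfolding R_def by blast+
  obtain r B where r: "strict_mono r" and B: "compact B" "B \<subseteq> unit_square"
    and conv: "AE x in lborel. \<forall>\<^sub>F j in sequentially. x \<in> P (r j) \<longleftrightarrow> x \<in> B"
    by (rule convex_selection[OF NP(2-5)])
  note conv' = borel_compact[OF NP(2)] NP(5) borel_compact[OF B(1)] B(2) conv
  have moments: "legendre_moment k l B = legendre_moment k l K" for k l
  proof (rule LIMSEQ_unique)
    show "(\<lambda>j. legendre_moment k l (P (r j))) \<longlonglongrightarrow> legendre_moment k l B"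
      by (rule legendre_moment_tendsto[OF conv'])
    have "(\<lambda>j. legendre_moment k l (P j) - legendre_moment k l K) \<longlonglongrightarrow> 0"
    proof (rule iffD1[OF power_tendsto_0_iff])
      show "(\<lambda>j. (legendre_moment k l (P j) - legendre_moment k l K)\<^sup>2) \<longlonglongrightarrow> 0"
      proof (rule tendsto_sandwich[OF _ _ tendsto_const LIMSEQ_inverse_real_of_nat])
        show "\<forall>\<^sub>F j in sequentially. (legendre_moment k l (P j) - legendre_moment k l K)\<^sup>2 \<le> inverse (real (Suc j))"
        proof (rule eventually_sequentiallyI)
          \<comment> \<open>From this index on the order \<open>N j\<close> covers the fixed pair
            \<open>k\<close>, \<open>l\<close>, so the single squared difference is one of the
            nonnegative summands.\<close>
          fix j assume "j \<ge> max k l"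
          then have "k \<le> N j" "l \<le> N j" using NP(1)[of j] by auto
          then have "(legendre_moment k l (P j) - legendre_moment k l K)\<^sup>2 \<le>
              (\<Sum>l\<le>N j. (legendre_moment k l (P j) - legendre_moment k l K)\<^sup>2)"
            by (intro member_le_sum) auto
          also have "\<dots> \<le> (\<Sum>k\<le>N j. \<Sum>l\<le>N j. (legendre_moment k l (P j) - legendre_moment k l K)\<^sup>2)"
            using \<open>k \<le> N j\<close>
            by (intro member_le_sum[of k _ "\<lambda>k. \<Sum>l\<le>N j. (legendre_moment k l (P j) - legendre_moment k l K)\<^sup>2"])
               (auto intro: sum_nonneg)
          finally show "(legendre_moment k l (P j) - legendre_moment k l K)\<^sup>2 \<le> inverse (real (Suc j))"
            using NP(6)[of j] by simp
        qed
      qed simp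
      show "(0::nat) < 2" by simp
    qed
    then have "(\<lambda>j. legendre_moment k l (P j)) \<longlonglongrightarrow> legendre_moment k l K"
      by (simp add: LIM_zero_iff)
    then show "(\<lambda>j. legendre_moment k l (P (r j))) \<longlonglongrightarrow> legendre_moment k l K"
      using LIMSEQ_subseq_LIMSEQ[OF _ r] by (auto simp: o_def)
  qed
  have "(\<lambda>j. nikodym_dist K (P (r j))) \<longlonglongrightarrow> nikodym_dist K B"
    by (rule nikodym_dist_tendsto[OF conv' borel_compact[OF K(1)] K(2)])
  also have "nikodym_dist K B = 0"
    using moments_eq_imp_nikodym_dist_0[OF K B] moments by simp
  finally have "\<eta> \<le> 0"
    using NP(7) by (intro LIMSEQ_le_const) (auto intro: less_imp_le)
  then show False using \<open>\<eta> > 0\<close> by simp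
qed

text \<open>The inequality \<open>sq\<close> is used on both sides of the minimality of
  \<open>P\<close>: first with the data between \<open>P\<close> and \<open>K\<close>, then with
  \<open>K\<close> between the data and \<open>Q\<close>. The constants are 4 = 2 * 2 and 6 = 2 * 2
  + 2.\<close>

lemma estimator_moment_bound:
  assumes P: "P \<in> least_squares_estimators N m ts" and Q: "Q \<in> polygons ts"
    and bQ: "Q \<in> sets borel" and K: "K \<in> sets borel" "K \<subseteq> unit_square"
  shows "(\<Sum>k\<le>N. \<Sum>l\<le>N. (legendre_moment k l P - legendre_moment k l K)\<^sup>2) \<le>
    4 * nikodym_dist K Q + 6 * (\<Sum>k\<le>N. \<Sum>l\<le>N. (m k l - legendre_moment k l K)\<^sup>2)"
proof -
  let ?E = "\<Sum>k\<le>N. \<Sum>l\<le>N. (m k l - legendre_moment k l K)\<^sup>2"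
  have sq: "(a - c :: real)\<^sup>2 \<le> 2 * (b - a)\<^sup>2 + 2 * (b - c)\<^sup>2" for a b c
    using zero_le_power2[of "(b - a) + (b - c)"] by (simp add: power2_eq_square algebra_simps)
  have Q_sub: "Q \<subseteq> unit_square" using Q by (auto simp: polygons_def)
  have "(\<Sum>k\<le>N. \<Sum>l\<le>N. (legendre_moment k l P - legendre_moment k l K)\<^sup>2) \<le>
      (\<Sum>k\<le>N. \<Sum>l\<le>N. 2 * (m k l - legendre_moment k l P)\<^sup>2 + 2 * (m k l - legendre_moment k l K)\<^sup>2)"
    by (intro sum_mono sq)
  also have "\<dots> = 2 * moment_error N m P + 2 * ?E"
    by (simp add: moment_error_def sum.distrib sum_distrib_left)
  also have "moment_error N m P \<le> moment_error N m Q"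
    using P Q by (auto simp: least_squares_estimators_def)
  also have "moment_error N m Q \<le>
      (\<Sum>k\<le>N. \<Sum>l\<le>N. 2 * (legendre_moment k l K - legendre_moment k l Q)\<^sup>2 + 2 * (m k l - legendre_moment k l K)\<^sup>2)"
    unfolding moment_error_def
  proof (intro sum_mono)
    fix k l
    show "(m k l - legendre_moment k l Q)\<^sup>2 \<le>
        2 * (legendre_moment k l K - legendre_moment k l Q)\<^sup>2 + 2 * (m k l - legendre_moment k l K)\<^sup>2"
      using sq[of "m k l" "legendre_moment k l Q" "legendre_moment k l K"]
      by (simp add: power2_commute[of "legendre_moment k l K" "m k l"])
  qed
  also have "\<dots> = 2 * (\<Sum>k\<le>N. \<Sum>l\<le>N. (legendre_moment k l K - legendre_moment k l Q)\<^sup>2) + 2 * ?E"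
    by (simp add: sum.distrib sum_distrib_left)
  also have "(\<Sum>k\<le>N. \<Sum>l\<le>N. (legendre_moment k l K - legendre_moment k l Q)\<^sup>2) \<le> nikodym_dist K Q"
    by (rule bessel_legendre_moment[OF K bQ Q_sub])
  finally show ?thesis by (simp add: algebra_simps)
qed

section \<open>Polygons with given normal directions\<close>

lemma polygon_eq: "polygon ts hs = {x. \<forall>i<length ts. x \<bullet> unit_dir (ts ! i) \<le> hs ! i}"
  by (auto simp: polygon_def)

lemma closed_polygon: "closed (polygon ts hs)"
  unfolding polygon_def inner_commute[of _ "unit_dir _"] by (intro closed_INT ballI closed_halfspace_le)

lemma convex_polygon: "convex (polygon ts hs)"
  unfolding polygon_def inner_commute[of _ "unit_dir _"] by (intro convex_INT convex_halfspace_le)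

lemma polygonsD:
  assumes "P \<in> polygons ts"
  shows "compact P" "convex P" "P \<noteq> {}" "P \<subseteq> unit_square"
proof -
  obtain hs where hs: "P = polygon ts hs" "consistent ts hs" and sub: "P \<subseteq> unit_square"
    using assms by (auto simp: polygons_def)
  show "compact P"
    using closed_polygon[of ts hs] sub compact_unit_square hs(1)
    by (metis closed_Int_compact inf.absorb_iff1)
  show "convex P" "P \<noteq> {}" "P \<subseteq> unit_square"
    using hs sub convex_polygon by (auto simp: consistent_def)
qed

lemma inner_unit_dir: "x \<bullet> unit_dir t = x $ 1 * cos t + x $ 2 * sin t"
  by (simp add: unit_dir_def inner_vec_def sum_2)

lemma norm_unit_dir [simp]: "norm (unit_dir t) = 1"
  by (simp add: norm_vec_def L2_set_def sum_2 unit_dir_def)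

lemma unit_dir_exists:
  assumes "norm v = 1"
  obtains t where "t \<in> {0..<2 * pi}" "v = unit_dir t"
proof -
  have "(v $ 1)\<^sup>2 + (v $ 2)\<^sup>2 = 1"
    using assms by (simp add: norm_vec_def L2_set_def sum_2)
  then obtain t where "0 \<le> t" "t < 2 * pi" "v $ 1 = cos t" "v $ 2 = sin t"
    using sincos_total_2pi by metis
  then show ?thesis using that[of t] by (simp add: unit_dir_def vec_eq_iff forall_2)
qed

lemma continuous_on_unit_dir [continuous_intros]: "continuous_on S unit_dir"
proof -
  have *: "unit_dir = (\<lambda>t. cos t *\<^sub>R axis 1 1 + sin t *\<^sub>R axis 2 1)"
    by (simp add: fun_eq_iff unit_dir_def vec_eq_iff forall_2 axis_def)
  show ?thesis by (subst *) (intro continuous_intros)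
qed

lemma axis_angle_inner:
  "x \<bullet> unit_dir 0 = x $ 1" "x \<bullet> unit_dir (pi / 2) = x $ 2"
  "x \<bullet> unit_dir pi = - x $ 1" "x \<bullet> unit_dir (3 * pi / 2) = - x $ 2"
  using cos_3over2_pi sin_3over2_pi by (simp_all add: inner_unit_dir)

text \<open>The second hypothesis says that no half-plane reaches beyond the supporting half-plane
  of the square with the same normal; in the four axis directions those supporting half-planes cut
  out the square itself.\<close>

lemma polygon_subset_unit_square:
  assumes ts: "{0, pi / 2, pi, 3 * pi / 2} \<subseteq> set ts"
    and hs: "\<And>i. i < length ts \<Longrightarrow> \<exists>y\<in>unit_square. hs ! i \<le> y \<bullet> unit_dir (ts ! i)"
  shows "polygon ts hs \<subseteq> unit_square"
proof
  fix x assume x: "x \<in> polygon ts hs"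
  have *: "\<exists>y\<in>unit_square. x \<bullet> unit_dir t \<le> y \<bullet> unit_dir t" if "t \<in> set ts" for t
  proof -
    obtain i where "i < length ts" "t = ts ! i" using \<open>t \<in> set ts\<close> by (metis in_set_conv_nth)
    moreover obtain y where "y \<in> unit_square" "hs ! i \<le> y \<bullet> unit_dir (ts ! i)"
      using hs \<open>i < length ts\<close> by blast
    moreover have "x \<bullet> unit_dir (ts ! i) \<le> hs ! i"
      using x \<open>i < length ts\<close> by (simp add: polygon_eq)
    ultimately show ?thesis by (metis order.trans)
  qed
  obtain a b c d where "a \<in> unit_square" "x $ 1 \<le> a $ 1" "b \<in> unit_square" "x $ 2 \<le> b $ 2"
    "c \<in> unit_square" "- x $ 1 \<le> - c $ 1" "d \<in> unit_square" "- x $ 2 \<le> - d $ 2"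
    using *[of 0] *[of "pi / 2"] *[of pi] *[of "3 * pi / 2"] ts unfolding axis_angle_inner by auto
  then show "x \<in> unit_square"
    by (simp add: unit_square_def forall_2)
qed

section \<open>Circumscribed polygons\<close>

definition circumscribed :: "real list \<Rightarrow> (real ^ 2) set \<Rightarrow> (real ^ 2) set" where
  "circumscribed ts K = polygon ts (map (\<lambda>t. support_fun K (unit_dir t)) ts)"

lemma mem_circumscribed: "x \<in> circumscribed ts K \<longleftrightarrow> (\<forall>t\<in>set ts. x \<bullet> unit_dir t \<le> support_fun K (unit_dir t))"
  by (simp add: circumscribed_def polygon_eq all_set_conv_all_nth)

text \<open>A point of \<open>K\<close> attaining the support value in a given direction lies in the
  polygon as well, so every constraint is tight and the vector of support values is
  consistent.\<close>

lemma circumscribed_mem_polygons: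
  assumes ts: "{0, pi / 2, pi, 3 * pi / 2} \<subseteq> set ts" and K: "compact K" "K \<noteq> {}" "K \<subseteq> unit_square"
  shows "circumscribed ts K \<in> polygons ts"
proof -
  let ?hs = "map (\<lambda>t. support_fun K (unit_dir t)) ts"
  have attained: "\<exists>y\<in>K. y \<bullet> v = support_fun K v" for v
    using support_fun_attained[OF K(1,2), of v] by metis
  have K_sub: "K \<subseteq> circumscribed ts K"
    using inner_le_support_fun[OF K(1)] by (auto simp: mem_circumscribed)
  have sub: "circumscribed ts K \<subseteq> unit_square"
    unfolding circumscribed_def
  proof (rule polygon_subset_unit_square[OF ts])
    fix i assume i: "i < length ts"
    obtain y where "y \<in> K" "y \<bullet> unit_dir (ts ! i) = support_fun K (unit_dir (ts ! i))"
      using attained by blast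
    then show "\<exists>y\<in>unit_square. ?hs ! i \<le> y \<bullet> unit_dir (ts ! i)"
      using K(3) i by (intro bexI[of _ y]) auto
  qed
  have "compact (circumscribed ts K)"
    using closed_polygon sub compact_unit_square
    by (metis circumscribed_def closed_Int_compact inf.absorb_iff1)
  have "support_fun (circumscribed ts K) (unit_dir (ts ! i)) = ?hs ! i" if "i < length ts" for i
  proof (rule antisym)
    obtain x where "x \<in> circumscribed ts K" "x \<bullet> unit_dir (ts ! i) = support_fun (circumscribed ts K) (unit_dir (ts ! i))"
      using support_fun_attained[OF \<open>compact (circumscribed ts K)\<close>] K_sub K(2) by (metis subset_empty)
    moreover from this(1) have "x \<bullet> unit_dir (ts ! i) \<le> support_fun K (unit_dir (ts ! i))"
      using that by (simp add: mem_circumscribed)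
    ultimately show "support_fun (circumscribed ts K) (unit_dir (ts ! i)) \<le> ?hs ! i"
      using that by simp
    obtain y where "y \<in> K" "y \<bullet> unit_dir (ts ! i) = support_fun K (unit_dir (ts ! i))"
      using attained by blast
    then show "?hs ! i \<le> support_fun (circumscribed ts K) (unit_dir (ts ! i))"
      using inner_le_support_fun[OF \<open>compact (circumscribed ts K)\<close>, of y "unit_dir (ts ! i)"] K_sub that by auto
  qed
  moreover have "circumscribed ts K \<noteq> {}" using K_sub K(2) by auto
  ultimately have "consistent ts ?hs"
    by (simp add: consistent_def circumscribed_def)
  then show ?thesis
    using sub unfolding polygons_def circumscribed_def by blast
qed

lemma circumscribed_tendsto:
  fixes \<theta> :: "nat \<Rightarrow> real"
  assumes K: "compact K" "convex K" "K \<noteq> {}" "K \<subseteq> unit_square"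
    and dense: "{0..<2 * pi} \<subseteq> closure (\<theta> ` {1..})"
    and ts: "\<And>n. set (ts n) = \<theta> ` {1..n}"
  shows "\<forall>\<^sub>F n in sequentially. x \<in> circumscribed (ts n) K \<longleftrightarrow> x \<in> K"
proof (cases "x \<in> K")
  case True
  then show ?thesis using inner_le_support_fun[OF K(1)] by (simp add: mem_circumscribed)
next
  case False
  obtain v where v: "norm v = 1" "support_fun K v < x \<bullet> v"
    using support_fun_separation[OF K(1-3) False] .
  obtain t where t: "t \<in> {0..<2 * pi}" "v = unit_dir t"
    using unit_dir_exists[OF v(1)] .
  \<comment> \<open>Subtracting the Lipschitz error makes \<open>0 < g s\<close> sufficient for the
    direction of angle \<open>s\<close> to cut off \<open>x\<close>. Positivity of \<open>g\<close>
    is an open condition satisfied at \<open>t\<close>, hence satisfied at some angle of the dense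
    sequence.\<close>
  define g where "g s = x \<bullet> unit_dir s - support_fun K (unit_dir t) - 2 * norm (unit_dir s - unit_dir t)" for s
  have "open {s. 0 < g s}"
    unfolding g_def by (intro open_Collect_less continuous_intros)
  moreover have "t \<in> {s. 0 < g s}" using v(2) t(2) by (simp add: g_def)
  ultimately obtain s where s: "s \<in> \<theta> ` {1..}" "0 < g s"
    using t(1) dense open_Int_closure_eq_empty[of "{s. 0 < g s}" "\<theta> ` {1..}"] by blast
  then obtain i where i: "i \<ge> 1" "s = \<theta> i" by auto
  have "support_fun K (unit_dir s) < x \<bullet> unit_dir s"
    using s(2) support_fun_le_add[OF K(1,3,4), of "unit_dir s" "unit_dir t"] by (simp add: g_def)
  then have "x \<notin> circumscribed (ts n) K" if "n \<ge> i" for n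
    using that i by (force simp: mem_circumscribed ts)
  then show ?thesis using False by (auto intro: eventually_sequentiallyI)
qed

lemma nikodym_dist_circumscribed_tendsto_0:
  fixes \<theta> :: "nat \<Rightarrow> real"
  assumes K: "compact K" "convex K" "K \<noteq> {}" "K \<subseteq> unit_square"
    and \<theta>: "{0..<2 * pi} \<subseteq> closure (\<theta> ` {1..})" "{0, pi / 2, pi, 3 * pi / 2} \<subseteq> \<theta> ` {1..4}"
    and ts: "\<And>n. set (ts n) = \<theta> ` {1..n}"
  shows "(\<lambda>n. nikodym_dist K (circumscribed (ts n) K)) \<longlonglongrightarrow> 0"
proof -
  \<comment> \<open>From 4 angles on all axis directions are present, so the polygons lie in the
    square as the convergence lemma requires. The shift does not affect the limit.\<close>
  let ?Q = "\<lambda>n. circumscribed (ts (n + 4)) K"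
  have "{0, pi / 2, pi, 3 * pi / 2} \<subseteq> set (ts (n + 4))" for n
    using \<theta>(2) by (auto simp: ts)
  then have Q: "?Q n \<in> polygons (ts (n + 4))" for n
    using K by (intro circumscribed_mem_polygons)
  have "(\<lambda>n. nikodym_dist K (?Q n)) \<longlonglongrightarrow> nikodym_dist K K"
  proof (rule nikodym_dist_tendsto)
    show "AE x in lborel. \<forall>\<^sub>F n in sequentially. x \<in> ?Q n \<longleftrightarrow> x \<in> K"
      using circumscribed_tendsto[OF K \<theta>(1) ts]
      by (intro AE_I2 eventually_compose_filterlim[OF _ filterlim_add_const_nat_at_top])
    show "?Q n \<in> sets borel" "?Q n \<subseteq> unit_square" for n
      using polygonsD[OF Q] by (auto intro: borel_compact)
  qed (use K in \<open>auto intro: borel_compact\<close>)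
  then show ?thesis
    using LIMSEQ_offset[of "\<lambda>n. nikodym_dist K (circumscribed (ts n) K)" 4] by (simp add: nikodym_dist_def)
qed

section \<open>Measurability of the worst error\<close>

text \<open>A consistent polygon is encoded by one contact point \<open>X i\<close> per edge direction, so that
  the support values \<open>X i \<bullet> u\<^sub>i\<close> are automatically attained and the parameter space is compact.
  The entries \<open>X i\<close> beyond the number of directions are irrelevant.\<close>

definition tuple_polygon :: "real list \<Rightarrow> (nat \<Rightarrow> real ^ 2) \<Rightarrow> (real ^ 2) set" where
  "tuple_polygon ts X = polygon ts (map (\<lambda>i. X i \<bullet> unit_dir (ts ! i)) [0..<length ts])"

definition touching_tuples :: "real list \<Rightarrow> (nat \<Rightarrow> real ^ 2) set" where
  "touching_tuples ts = {X. (\<forall>i. X i \<in> unit_square) \<and>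
     (\<forall>i<length ts. \<forall>j<length ts. X j \<bullet> unit_dir (ts ! i) \<le> X i \<bullet> unit_dir (ts ! i))}"

lemma mem_tuple_polygon:
  "x \<in> tuple_polygon ts X \<longleftrightarrow> (\<forall>i<length ts. x \<bullet> unit_dir (ts ! i) \<le> X i \<bullet> unit_dir (ts ! i))"
  by (auto simp: tuple_polygon_def polygon_eq)

lemma continuous_on_component_inner:
  fixes v :: "'b::real_inner"
  shows "continuous_on S (\<lambda>X :: 'i \<Rightarrow> 'b. X i \<bullet> v)"
  by (intro continuous_intros continuous_on_subset[OF continuous_on_product_coordinates]) auto

lemma compact_touching_tuples: "compact (touching_tuples ts)"
proof -
  have "touching_tuples ts = PiE UNIV (\<lambda>_. unit_square) \<inter>
      (\<Inter>i\<in>{..<length ts}. \<Inter>j\<in>{..<length ts}. {X. X j \<bullet> unit_dir (ts ! i) \<le> X i \<bullet> unit_dir (ts ! i)})"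
    by (auto simp: touching_tuples_def)
  also have "compact \<dots>"
    by (intro compact_Int_closed compact_PiE_UNIV compact_unit_square closed_INT ballI
        closed_Collect_le continuous_on_component_inner)
  finally show ?thesis .
qed

lemma touching_tuples_nonempty: "touching_tuples ts \<noteq> {}"
proof -
  have "(\<lambda>_. 0) \<in> touching_tuples ts" by (simp add: touching_tuples_def unit_square_def)
  then show ?thesis by blast
qed

lemma tuple_polygon_subset_unit_square:
  assumes ts: "{0, pi / 2, pi, 3 * pi / 2} \<subseteq> set ts" and X: "X \<in> touching_tuples ts"
  shows "tuple_polygon ts X \<subseteq> unit_square"
  unfolding tuple_polygon_def
proof (rule polygon_subset_unit_square[OF ts])
  fix i assume "i < length ts"
  then show "\<exists>y\<in>unit_square. map (\<lambda>i. X i \<bullet> unit_dir (ts ! i)) [0..<length ts] ! i \<le> y \<bullet> unit_dir (ts ! i)"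
    using X by (intro bexI[of _ "X i"]) (auto simp: touching_tuples_def)
qed

lemma closed_tuple_polygon: "closed (tuple_polygon ts X)"
  unfolding tuple_polygon_def by (rule closed_polygon)

text \<open>The inequalities of a touching tuple say that each relevant \<open>X i\<close> lies in
  the polygon it helps to define, where the constraint with index \<open>i\<close> is tight;
  conversely, contact points of a consistent polygon form such a tuple.\<close>

lemma polygons_eq_image:
  assumes ts: "{0, pi / 2, pi, 3 * pi / 2} \<subseteq> set ts"
  shows "polygons ts = tuple_polygon ts ` touching_tuples ts"
proof (intro equalityI subsetI)
  fix P assume P: "P \<in> polygons ts"
  then obtain hs where hs: "P = polygon ts hs" "consistent ts hs" by (auto simp: polygons_def)
  note P' = polygonsD[OF P]
  \<comment> \<open>Indices beyond the list still receive a point of \<open>P\<close>, because all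
    entries of a touching tuple must lie in the square.\<close>
  have "\<exists>x. x \<in> P \<and> (i < length ts \<longrightarrow> x \<bullet> unit_dir (ts ! i) = hs ! i)" for i
    using support_fun_attained[OF P'(1,3), of "unit_dir (ts ! i)"] P'(3) hs
    unfolding consistent_def by metis
  then obtain X where X: "\<And>i. X i \<in> P" "\<And>i. i < length ts \<Longrightarrow> X i \<bullet> unit_dir (ts ! i) = hs ! i"
    by metis
  have "X \<in> touching_tuples ts"
    using X P'(4) hs(1) by (auto simp: touching_tuples_def polygon_eq)
  moreover have "map (\<lambda>i. X i \<bullet> unit_dir (ts ! i)) [0..<length ts] = hs"
    using X(2) hs(2) by (auto simp: consistent_def intro!: nth_equalityI)
  then have "P = tuple_polygon ts X" by (simp add: tuple_polygon_def hs(1))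
  ultimately show "P \<in> tuple_polygon ts ` touching_tuples ts" by blast
next
  fix P assume "P \<in> tuple_polygon ts ` touching_tuples ts"
  then obtain X where X: "X \<in> touching_tuples ts" and P: "P = tuple_polygon ts X" by blast
  let ?hs = "map (\<lambda>i. X i \<bullet> unit_dir (ts ! i)) [0..<length ts]"
  have sub: "P \<subseteq> unit_square"
    unfolding P by (rule tuple_polygon_subset_unit_square[OF ts X])
  have "compact P"
    using closed_tuple_polygon[of ts X] sub compact_unit_square P by (metis closed_Int_compact inf.absorb_iff1)
  have mem: "X i \<in> P" if "i < length ts" for i
    using X that by (auto simp: P mem_tuple_polygon touching_tuples_def)
  have "length ts > 0" using ts by auto
  then have "P \<noteq> {}" using mem by auto
  have "support_fun P (unit_dir (ts ! i)) = X i \<bullet> unit_dir (ts ! i)" if "i < length ts" for i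
  proof (rule antisym)
    obtain x where "x \<in> P" "x \<bullet> unit_dir (ts ! i) = support_fun P (unit_dir (ts ! i))"
      using support_fun_attained[OF \<open>compact P\<close> \<open>P \<noteq> {}\<close>] by metis
    then show "support_fun P (unit_dir (ts ! i)) \<le> X i \<bullet> unit_dir (ts ! i)"
      using that by (auto simp: P mem_tuple_polygon)
    show "X i \<bullet> unit_dir (ts ! i) \<le> support_fun P (unit_dir (ts ! i))"
      using inner_le_support_fun[OF \<open>compact P\<close> mem[OF that]] .
  qed
  then have "consistent ts ?hs"
    using \<open>P \<noteq> {}\<close> by (simp add: consistent_def P tuple_polygon_def)
  then show "P \<in> polygons ts"
    using sub unfolding polygons_def P tuple_polygon_def by blast
qed

lemma AE_not_in_hyperplane:
  fixes a :: "'a::euclidean_space"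
  assumes "a \<noteq> 0"
  shows "AE x in lborel. x \<bullet> a \<noteq> b"
proof -
  have "AE x in lborel. x \<notin> frontier {x. a \<bullet> x \<le> b}"
    by (rule AE_not_in_frontier_convex) (rule convex_halfspace_le)
  moreover have "frontier {x. a \<bullet> x \<le> b} = {x. a \<bullet> x = b}"
    using assms by (simp add: frontier_halfspace_le)
  ultimately show ?thesis
    by (simp add: inner_commute)
qed

text \<open>Off the finitely many bounding lines of the limit polygon all constraints are strict,
  satisfied or violated, and strict inequalities persist near the limit. Degenerate limits without
  interior are covered.\<close>

lemma tuple_polygon_tendsto:
  assumes lim: "X \<longlonglongrightarrow> Y"
  shows "AE x in lborel. \<forall>\<^sub>F m in sequentially. x \<in> tuple_polygon ts (X m) \<longleftrightarrow> x \<in> tuple_polygon ts Y"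
proof -
  let ?u = "\<lambda>i. unit_dir (ts ! i)"
  have lim_i: "(\<lambda>m. X m i \<bullet> ?u i) \<longlonglongrightarrow> Y i \<bullet> ?u i" for i
    by (rule tendsto_inner[OF tendsto_fun_component[OF lim] tendsto_const])
  have "AE x in lborel. \<forall>i\<in>{..<length ts}. x \<bullet> ?u i \<noteq> Y i \<bullet> ?u i"
  proof (rule AE_finite_allI)
    fix i
    have "?u i \<noteq> 0" using norm_unit_dir[of "ts ! i"] by force
    then show "AE x in lborel. x \<bullet> ?u i \<noteq> Y i \<bullet> ?u i" by (rule AE_not_in_hyperplane)
  qed simp
  then show ?thesis
  proof eventually_elim
    case (elim x)
    show ?case
    proof (cases "x \<in> tuple_polygon ts Y")
      case True
      have "\<forall>\<^sub>F m in sequentially. \<forall>i\<in>{..<length ts}. x \<bullet> ?u i < X m i \<bullet> ?u i"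
      proof (intro eventually_ball_finite ballI)
        fix i assume "i \<in> {..<length ts}"
        then have "x \<bullet> ?u i < Y i \<bullet> ?u i"
          using True elim by (force simp: mem_tuple_polygon)
        then show "\<forall>\<^sub>F m in sequentially. x \<bullet> ?u i < X m i \<bullet> ?u i"
          using lim_i order_tendstoD(1) by blast
      qed simp
      then show ?thesis
        by eventually_elim (use True in \<open>auto simp: mem_tuple_polygon less_imp_le\<close>)
    next
      case False
      then obtain i where i: "i < length ts" "Y i \<bullet> ?u i < x \<bullet> ?u i"
        by (auto simp: mem_tuple_polygon not_le)
      then have "\<forall>\<^sub>F m in sequentially. X m i \<bullet> ?u i < x \<bullet> ?u i"
        using lim_i order_tendstoD(2) by blast
      then show ?thesis
        by eventually_elim (use False i(1) in \<open>force simp: mem_tuple_polygon\<close>)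
    qed
  qed
qed

lemma continuous_on_legendre_moment_tuple_polygon:
  assumes ts: "{0, pi / 2, pi, 3 * pi / 2} \<subseteq> set ts"
  shows "continuous_on (touching_tuples ts) (\<lambda>X. legendre_moment k l (tuple_polygon ts X))"
proof (rule continuous_on_sequentiallyI)
  fix X Y assume "\<forall>n. X n \<in> touching_tuples ts" "Y \<in> touching_tuples ts" and lim: "X \<longlonglongrightarrow> Y"
  then show "(\<lambda>n. legendre_moment k l (tuple_polygon ts (X n))) \<longlonglongrightarrow> legendre_moment k l (tuple_polygon ts Y)"
    using borel_closed[OF closed_tuple_polygon] tuple_polygon_subset_unit_square[OF ts]
    by (intro legendre_moment_tendsto tuple_polygon_tendsto[OF lim]) simp_all
qed

lemma continuous_on_nikodym_dist_tuple_polygon: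
  assumes ts: "{0, pi / 2, pi, 3 * pi / 2} \<subseteq> set ts" and K: "K \<in> sets borel" "K \<subseteq> unit_square"
  shows "continuous_on (touching_tuples ts) (\<lambda>X. nikodym_dist K (tuple_polygon ts X))"
proof (rule continuous_on_sequentiallyI)
  fix X Y assume "\<forall>n. X n \<in> touching_tuples ts" "Y \<in> touching_tuples ts" and lim: "X \<longlonglongrightarrow> Y"
  then show "(\<lambda>n. nikodym_dist K (tuple_polygon ts (X n))) \<longlonglongrightarrow> nikodym_dist K (tuple_polygon ts Y)"
    using borel_closed[OF closed_tuple_polygon] tuple_polygon_subset_unit_square[OF ts]
    by (intro nikodym_dist_tendsto tuple_polygon_tendsto[OF lim] K) simp_all
qed

section \<open>Semicontinuity of the maximum over minimizers\<close>

text \<open>Minimizers for convergent parameters accumulate in the compact set \<open>C\<close>, and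
  joint continuity passes each inequality \<open>F m x \<le> F m y\<close> to the limit, so the
  accumulation point minimizes for the limit parameter; continuity of \<open>g\<close> preserves the
  level \<open>c\<close>.\<close>

lemma closed_argmin_superlevel:
  fixes F :: "'m::metric_space \<Rightarrow> 'x::metric_space \<Rightarrow> real" and g :: "'x \<Rightarrow> real"
  assumes C: "compact C" and F: "continuous_on (UNIV \<times> C) (\<lambda>(m, x). F m x)" and g: "continuous_on C g"
  shows "closed {m. \<exists>x\<in>C. c \<le> g x \<and> (\<forall>y\<in>C. F m x \<le> F m y)}"
  unfolding closed_sequential_limits
proof (intro allI impI, elim conjE)
  fix m l assume m: "\<forall>n. m n \<in> {m. \<exists>x\<in>C. c \<le> g x \<and> (\<forall>y\<in>C. F m x \<le> F m y)}" and lim: "m \<longlonglongrightarrow> l"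
  then have "\<forall>n. \<exists>x. x \<in> C \<and> c \<le> g x \<and> (\<forall>y\<in>C. F (m n) x \<le> F (m n) y)" by blast
  then obtain x where x: "\<And>n. x n \<in> C" "\<And>n. c \<le> g (x n)" "\<And>n y. y \<in> C \<Longrightarrow> F (m n) (x n) \<le> F (m n) y"
    by metis
  obtain a r where a: "a \<in> C" and r: "strict_mono (r :: nat \<Rightarrow> nat)" and lim_x: "(x \<circ> r) \<longlonglongrightarrow> a"
    using C x(1) unfolding compact_def by blast
  have lim_m: "(\<lambda>n. m (r n)) \<longlonglongrightarrow> l"
    using LIMSEQ_subseq_LIMSEQ[OF lim r] by (simp add: o_def)
  have F_lim: "(\<lambda>n. F (m (r n)) (z n)) \<longlonglongrightarrow> F l b" if "z \<longlonglongrightarrow> b" "\<And>n. z n \<in> C" "b \<in> C" for z b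
    using continuous_on_tendsto_compose[OF F tendsto_Pair[OF lim_m that(1)]] that(2,3) by simp
  have "(\<lambda>n. g (x (r n))) \<longlonglongrightarrow> g a"
    using continuous_on_tendsto_compose[OF g lim_x a] x(1) by simp
  then have "c \<le> g a"
    by (rule tendsto_lowerbound) (simp_all add: x(2))
  moreover have "F l a \<le> F l y" if "y \<in> C" for y
  proof (rule LIMSEQ_le)
    show "(\<lambda>n. F (m (r n)) (x (r n))) \<longlonglongrightarrow> F l a"
      using F_lim[of "x \<circ> r"] lim_x x(1) a by simp
    show "(\<lambda>n. F (m (r n)) y) \<longlonglongrightarrow> F l y"
      using F_lim[of "\<lambda>_. y"] that by simp
  qed (use x(3) that in blast)
  ultimately show "l \<in> {m. \<exists>x\<in>C. c \<le> g x \<and> (\<forall>y\<in>C. F m x \<le> F m y)}" using a by blast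
qed

lemma least_squares_estimators_eq_image:
  assumes ts: "{0, pi / 2, pi, 3 * pi / 2} \<subseteq> set ts"
  shows "least_squares_estimators N m ts = tuple_polygon ts ` {X \<in> touching_tuples ts.
    \<forall>Y\<in>touching_tuples ts. moment_error N m (tuple_polygon ts X) \<le> moment_error N m (tuple_polygon ts Y)}"
  unfolding least_squares_estimators_def polygons_eq_image[OF ts] by blast

text \<open>The data are uncurried so that they form a function space over one countable index type.
  This space is metrizable, as the closedness argument needs, and Borel measurability into it can be
  checked coordinatewise.\<close>

lemma continuous_on_moment_error_tuple_polygon:
  assumes ts: "{0, pi / 2, pi, 3 * pi / 2} \<subseteq> set ts"
  shows "continuous_on (UNIV \<times> touching_tuples ts)
    (\<lambda>(m, X). moment_error N (curry m) (tuple_polygon ts X))"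
proof -
  let ?S = "(UNIV :: (nat \<times> nat \<Rightarrow> real) set) \<times> touching_tuples ts"
  have "continuous_on ?S (\<lambda>z. fst z i)" for i
    by (rule continuous_on_compose2[OF continuous_on_product_coordinates continuous_on_fst[OF continuous_on_id]]) auto
  moreover have "continuous_on ?S (\<lambda>z. legendre_moment k l (tuple_polygon ts (snd z)))" for k l
    by (rule continuous_on_compose2[OF continuous_on_legendre_moment_tuple_polygon[OF ts] continuous_on_snd[OF continuous_on_id]]) auto
  ultimately show ?thesis
    unfolding moment_error_def case_prod_beta curry_def
    by (intro continuous_on_sum continuous_on_power continuous_on_diff)
qed

text \<open>Existence matters because a real supremum over the empty set is unspecified; attainment
  lets bounds on a single estimator become statements about the supremum.\<close>

lemma least_squares_sup_attained:
  assumes ts: "{0, pi / 2, pi, 3 * pi / 2} \<subseteq> set ts" and K: "K \<in> sets borel" "K \<subseteq> unit_square"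
  obtains P where "P \<in> least_squares_estimators N m ts"
    "nikodym_dist K P = (SUP P\<in>least_squares_estimators N m ts. nikodym_dist K P)"
    "\<forall>P'\<in>least_squares_estimators N m ts. nikodym_dist K P' \<le> nikodym_dist K P"
proof -
  let ?C = "touching_tuples ts" and ?F = "\<lambda>X. moment_error N m (tuple_polygon ts X)"
  have cont: "continuous_on ?C ?F"
    unfolding moment_error_def by (intro continuous_intros continuous_on_legendre_moment_tuple_polygon[OF ts])
  obtain X0 where X0: "X0 \<in> ?C" "\<forall>Y\<in>?C. ?F X0 \<le> ?F Y"
    using continuous_attains_inf[OF compact_touching_tuples touching_tuples_nonempty cont] by blast
  define A where "A = {X \<in> ?C. \<forall>Y\<in>?C. ?F X \<le> ?F Y}"
  \<comment> \<open>The set of minimizers is the sublevel set at the minimum value, which makes it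
    closed.\<close>
  have "A = {X \<in> ?C. ?F X \<le> ?F X0} \<inter> ?C"
    using X0 by (auto simp: A_def intro: order.trans)
  moreover have "closed {X \<in> ?C. ?F X \<le> ?F X0}"
    using cont compact_touching_tuples by (intro continuous_on_closed_Collect_le continuous_on_const compact_imp_closed)
  ultimately have "compact A"
    using compact_touching_tuples by (simp add: closed_Int_compact)
  moreover have "A \<noteq> {}" using X0 by (auto simp: A_def)
  moreover have "continuous_on A (\<lambda>X. nikodym_dist K (tuple_polygon ts X))"
    by (rule continuous_on_subset[OF continuous_on_nikodym_dist_tuple_polygon[OF ts K]]) (auto simp: A_def)
  ultimately obtain X where X: "X \<in> A"
    "\<forall>Y\<in>A. nikodym_dist K (tuple_polygon ts Y) \<le> nikodym_dist K (tuple_polygon ts X)"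
    using continuous_attains_sup by blast
  have eq: "least_squares_estimators N m ts = tuple_polygon ts ` A"
    unfolding A_def by (rule least_squares_estimators_eq_image[OF ts])
  have max: "\<forall>P\<in>least_squares_estimators N m ts. nikodym_dist K P \<le> nikodym_dist K (tuple_polygon ts X)"
    using X(2) unfolding eq by simp
  have mem: "tuple_polygon ts X \<in> least_squares_estimators N m ts"
    using X(1) unfolding eq by simp
  have "(SUP P\<in>least_squares_estimators N m ts. nikodym_dist K P) = nikodym_dist K (tuple_polygon ts X)"
    by (rule cSup_eq_maximum) (use max mem in auto)
  then show ?thesis by (intro that[OF mem _ max]) simp
qed

lemma borel_measurable_worst_error:
  fixes m :: "'w \<Rightarrow> nat \<Rightarrow> nat \<Rightarrow> real"
  assumes ts: "{0, pi / 2, pi, 3 * pi / 2} \<subseteq> set ts" and K: "K \<in> sets borel" "K \<subseteq> unit_square"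
    and m: "\<And>k l. k \<le> N \<Longrightarrow> l \<le> N \<Longrightarrow> (\<lambda>\<omega>. m \<omega> k l) \<in> borel_measurable M"
  shows "(\<lambda>\<omega>. SUP P\<in>least_squares_estimators N (m \<omega>) ts. nikodym_dist K P) \<in> borel_measurable M"
proof -
  \<comment> \<open>Measurability of \<open>m\<close> is available only up to order
    \<open>N\<close>. The remaining coordinates are set to 0, and the moment error does not see
    them.\<close>
  define v where "v \<omega> = (\<lambda>(k, l). if k \<le> N \<and> l \<le> N then m \<omega> k l else 0)" for \<omega>
  have [measurable]: "v \<in> borel_measurable M"
  proof (rule measurable_coordinatewise_then_product)
    fix i :: "nat \<times> nat"
    show "(\<lambda>\<omega>. v \<omega> i) \<in> borel_measurable M"
      using m[of "fst i" "snd i"]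
      by (cases "fst i \<le> N \<and> snd i \<le> N") (auto simp: v_def case_prod_beta)
  qed
  have error: "moment_error N (m \<omega>) = moment_error N (curry (v \<omega>))" for \<omega>
    by (rule ext) (simp add: moment_error_def v_def)
  let ?C = "touching_tuples ts"
  define S where "S c = {u. \<exists>X\<in>?C. c \<le> nikodym_dist K (tuple_polygon ts X) \<and>
      (\<forall>Y\<in>?C. moment_error N (curry u) (tuple_polygon ts X) \<le> moment_error N (curry u) (tuple_polygon ts Y))}" for c
  have "closed (S c)" for c
    unfolding S_def
    by (rule closed_argmin_superlevel[OF compact_touching_tuples
          continuous_on_moment_error_tuple_polygon[OF ts] continuous_on_nikodym_dist_tuple_polygon[OF ts K]])
  then have [measurable]: "S c \<in> sets borel" for c by (rule borel_closed)
  \<comment> \<open>Because the supremum is a maximum, reaching level \<open>c\<close> is the same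
    as having one estimator at distance at least \<open>c\<close>.\<close>
  have "c \<le> (SUP P\<in>least_squares_estimators N (m \<omega>) ts. nikodym_dist K P) \<longleftrightarrow> v \<omega> \<in> S c" for c \<omega>
  proof -
    obtain P where P: "P \<in> least_squares_estimators N (m \<omega>) ts"
      "nikodym_dist K P = (SUP P\<in>least_squares_estimators N (m \<omega>) ts. nikodym_dist K P)"
      "\<forall>P'\<in>least_squares_estimators N (m \<omega>) ts. nikodym_dist K P' \<le> nikodym_dist K P"
      by (rule least_squares_sup_attained[OF ts K, of N "m \<omega>"])
    have "v \<omega> \<in> S c \<longleftrightarrow> (\<exists>P\<in>least_squares_estimators N (m \<omega>) ts. c \<le> nikodym_dist K P)"
      unfolding least_squares_estimators_eq_image[OF ts] S_def error by blast
    also have "\<dots> \<longleftrightarrow> c \<le> nikodym_dist K P"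
      using P(1) P(3) order.trans by blast
    finally show ?thesis unfolding P(2) ..
  qed
  then have "{\<omega> \<in> space M. c \<le> (SUP P\<in>least_squares_estimators N (m \<omega>) ts. nikodym_dist K P)} =
      v -` S c \<inter> space M" for c
    by auto
  moreover have "v -` S c \<inter> space M \<in> sets M" for c by measurable
  ultimately show ?thesis
    unfolding borel_measurable_iff_ge by simp
qed

section \<open>Convergence\<close>

lemma worst_error_bounds:
  assumes ts: "{0, pi / 2, pi, 3 * pi / 2} \<subseteq> set ts" and K: "K \<in> sets borel" "K \<subseteq> unit_square"
  shows "0 \<le> (SUP P\<in>least_squares_estimators N m ts. nikodym_dist K P)"
    and "(SUP P\<in>least_squares_estimators N m ts. nikodym_dist K P) \<le> 1"
proof -
  obtain P where P: "P \<in> least_squares_estimators N m ts"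
    "nikodym_dist K P = (SUP P\<in>least_squares_estimators N m ts. nikodym_dist K P)"
    by (rule least_squares_sup_attained[OF ts K, of N m])
  then have "P \<in> polygons ts" by (simp add: least_squares_estimators_def)
  note P' = polygonsD[OF this]
  show "0 \<le> (SUP P\<in>least_squares_estimators N m ts. nikodym_dist K P)"
    unfolding P(2)[symmetric] by (rule nikodym_dist_nonneg)
  show "(SUP P\<in>least_squares_estimators N m ts. nikodym_dist K P) \<le> 1"
    unfolding P(2)[symmetric] by (intro nikodym_dist_le_1 K P'(4) borel_compact P'(1))
qed

text \<open>The deterministic core: \<open>m\<close> is quantified after \<delta> and
  \<open>N\<^sub>0\<close>, so random data can be inserted for every sample point at once.\<close>

lemma worst_error_stability:
  fixes \<theta> :: "nat \<Rightarrow> real"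
  assumes K: "compact K" "convex K" "K \<noteq> {}" "K \<subseteq> unit_square"
    and \<theta>: "{0..<2 * pi} \<subseteq> closure (\<theta> ` {1..})" "{0, pi / 2, pi, 3 * pi / 2} \<subseteq> \<theta> ` {1..4}"
    and ts: "\<And>n. set (ts n) = \<theta> ` {1..n}" and "\<eta> > 0"
  obtains \<delta> N\<^sub>0 where "\<delta> > 0" "N\<^sub>0 \<ge> 4" and
    "\<And>n N m. \<lbrakk>n \<ge> N\<^sub>0; N \<ge> N\<^sub>0; (\<Sum>k\<le>N. \<Sum>l\<le>N. (m k l - legendre_moment k l K)\<^sup>2) \<le> \<delta>\<rbrakk>
       \<Longrightarrow> (SUP P\<in>least_squares_estimators N m (ts n). nikodym_dist K P) \<le> \<eta>"
proof -
  have bK: "K \<in> sets borel" using K(1) by (rule borel_compact)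
  obtain \<delta> N1 where "\<delta> > 0" and stab:
    "\<And>N P. \<lbrakk>N \<ge> N1; compact P; convex P; P \<noteq> {}; P \<subseteq> unit_square;
       (\<Sum>k\<le>N. \<Sum>l\<le>N. (legendre_moment k l P - legendre_moment k l K)\<^sup>2) \<le> \<delta>\<rbrakk>
       \<Longrightarrow> nikodym_dist K P \<le> \<eta>"
    using convex_stability[OF K(1,4) \<open>\<eta> > 0\<close>] by blast
  have "\<forall>\<^sub>F n in sequentially. nikodym_dist K (circumscribed (ts n) K) < \<delta> / 8"
    using nikodym_dist_circumscribed_tendsto_0[OF K \<theta> ts] \<open>\<delta> > 0\<close> by (intro order_tendstoD(2)) auto
  then obtain N2 where N2: "\<And>n. n \<ge> N2 \<Longrightarrow> nikodym_dist K (circumscribed (ts n) K) < \<delta> / 8"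
    by (auto simp: eventually_sequentially)
  show ?thesis
  \<comment> \<open>The tolerance is split evenly: 4 * (\<delta> / 8) + 6 * (\<delta> / 12) =
    \<delta>. The lower bound 4 guarantees the axis directions.\<close>
  proof (rule that[of "\<delta> / 12" "max 4 (max N1 N2)"])
    fix n N m
    assume n: "max 4 (max N1 N2) \<le> n" and N: "max 4 (max N1 N2) \<le> N"
      and m: "(\<Sum>k\<le>N. \<Sum>l\<le>N. (m k l - legendre_moment k l K)\<^sup>2) \<le> \<delta> / 12"
    have axes: "{0, pi / 2, pi, 3 * pi / 2} \<subseteq> set (ts n)"
      using \<theta>(2) image_mono[of "{1..4}" "{1..n}" \<theta>] n by (auto simp: ts)
    have Q: "circumscribed (ts n) K \<in> polygons (ts n)"
      using axes K(1,3,4) by (rule circumscribed_mem_polygons)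
    have "circumscribed (ts n) K \<in> sets borel"
      using polygonsD(1)[OF Q] by (rule borel_compact)
    obtain P where P: "P \<in> least_squares_estimators N m (ts n)"
      "nikodym_dist K P = (SUP P\<in>least_squares_estimators N m (ts n). nikodym_dist K P)"
      by (rule least_squares_sup_attained[OF axes bK K(4), of N m])
    have "P \<in> polygons (ts n)" using P(1) by (simp add: least_squares_estimators_def)
    note P' = polygonsD[OF this]
    have "(\<Sum>k\<le>N. \<Sum>l\<le>N. (legendre_moment k l P - legendre_moment k l K)\<^sup>2) \<le> \<delta>"
      using estimator_moment_bound[OF P(1) Q \<open>circumscribed (ts n) K \<in> sets borel\<close> bK K(4)] m N2[of n] n
      by simp
    then have "nikodym_dist K P \<le> \<eta>"
      using stab[of N P] P' N by simp
    then show "(SUP P\<in>least_squares_estimators N m (ts n). nikodym_dist K P) \<le> \<eta>"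
      unfolding P(2) .
  qed (use \<open>\<delta> > 0\<close> in auto)
qed

section \<open>Modes of convergence and size of the noise\<close>

lemma tendsto_in_mean_imp_in_prob:
  assumes mean: "tendsto_in_mean M X (\<lambda>_. 0) F"
  shows "tendsto_in_prob M X (\<lambda>_. 0) F"
  unfolding tendsto_in_prob_def
proof (intro conjI allI impI)
  have int: "\<forall>\<^sub>F i in F. integrable M (X i)" and lim: "((\<lambda>i. \<integral>\<omega>. \<bar>X i \<omega>\<bar> \<partial>M) \<longlongrightarrow> 0) F"
    using mean by (auto simp: tendsto_in_mean_def)
  show "\<forall>\<^sub>F i in F. X i \<in> borel_measurable M"
    using int by eventually_elim (rule borel_measurable_integrable)
  show "(\<lambda>_. 0) \<in> borel_measurable M" by simp
  fix e :: real assume "e > 0"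
  show "((\<lambda>i. measure M {\<omega> \<in> space M. e < \<bar>X i \<omega> - 0\<bar>}) \<longlongrightarrow> 0) F"
  proof (rule tendsto_sandwich[OF _ _ tendsto_const])
    show "((\<lambda>i. (\<integral>\<omega>. \<bar>X i \<omega>\<bar> \<partial>M) / e) \<longlongrightarrow> 0) F"
      by (rule tendsto_divide_zero[OF lim])
    show "\<forall>\<^sub>F i in F. measure M {\<omega> \<in> space M. e < \<bar>X i \<omega> - 0\<bar>} \<le> (\<integral>\<omega>. \<bar>X i \<omega>\<bar> \<partial>M) / e"
      using int
    proof eventually_elim
      case (elim i)
      have abs_int: "integrable M (\<lambda>\<omega>. \<bar>X i \<omega>\<bar>)"
        using elim by (rule integrable_abs)
      have [measurable]: "X i \<in> borel_measurable M"
        using elim by (rule borel_measurable_integrable)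
      \<comment> \<open>\<open>measure\<close> returns 0 on sets of infinite measure, and
        \<open>M\<close> is arbitrary here, so finiteness has to precede monotonicity.\<close>
      have "emeasure M {\<omega> \<in> space M. e \<le> \<bar>X i \<omega>\<bar>} \<le> ennreal ((1 / e) * (\<integral>\<omega>. \<bar>X i \<omega>\<bar> \<partial>M))"
        by (rule integral_Markov_inequality[OF abs_int _ \<open>e > 0\<close>]) simp
      also have "\<dots> < top" by (rule ennreal_less_top)
      finally have "{\<omega> \<in> space M. e \<le> \<bar>X i \<omega>\<bar>} \<in> fmeasurable M"
        by (intro fmeasurableI) (auto simp: infinity_ennreal_def)
      then have "measure M {\<omega> \<in> space M. e < \<bar>X i \<omega> - 0\<bar>} \<le> measure M {\<omega> \<in> space M. e \<le> \<bar>X i \<omega>\<bar>}"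
        by (intro measure_mono_fmeasurable) auto
      also have "\<dots> \<le> (\<integral>\<omega>. \<bar>X i \<omega>\<bar> \<partial>M) / e"
        by (rule integral_Markov_inequality_measure[OF abs_int sets.top _ \<open>e > 0\<close>]) simp
      finally show ?case .
    qed
  qed simp
qed

text \<open>By Tonelli the sum of the \<open>X n\<close> has finite integral, hence is finite almost
  everywhere, and the terms of a convergent series tend to 0. No independence enters.\<close>

lemma AE_tendsto_0_of_summable_integral:
  fixes X :: "nat \<Rightarrow> 'w \<Rightarrow> real"
  assumes X: "\<And>n. integrable M (X n)" "\<And>n \<omega>. 0 \<le> X n \<omega>" and sum: "summable (\<lambda>n. \<integral>\<omega>. X n \<omega> \<partial>M)"
  shows "AE \<omega> in M. (\<lambda>n. X n \<omega>) \<longlonglongrightarrow> 0"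
proof -
  have [measurable]: "X n \<in> borel_measurable M" for n
    using X(1) by (rule borel_measurable_integrable)
  have "(\<integral>\<^sup>+ \<omega>. (\<Sum>n. ennreal (X n \<omega>)) \<partial>M) = (\<Sum>n. \<integral>\<^sup>+ \<omega>. ennreal (X n \<omega>) \<partial>M)"
    by (rule nn_integral_suminf) measurable
  also have "\<dots> = (\<Sum>n. ennreal (\<integral>\<omega>. X n \<omega> \<partial>M))"
    by (simp add: nn_integral_eq_integral X)
  also have "\<dots> \<noteq> \<infinity>"
    unfolding infinity_ennreal_def
    by (rule ennreal_suminf_neq_top[OF sum Bochner_Integration.integral_nonneg[OF X(2)]])
  finally have "AE \<omega> in M. (\<Sum>n. ennreal (X n \<omega>)) \<noteq> \<infinity>"
    by (intro nn_integral_PInf_AE) auto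
  then show ?thesis
  proof eventually_elim
    case (elim \<omega>)
    then have "summable (\<lambda>n. X n \<omega>)"
      using X(2) by (intro summable_suminf_not_top) auto
    then show ?case by (rule summable_LIMSEQ_zero)
  qed
qed

text \<open>The number of noise terms costs two powers of \<open>N\<close>. The factor 4 in the
  proof comes from N + 1 \<le> 2 N for N \<ge> 1.\<close>

lemma noise_energy_bigo:
  fixes \<sigma> V :: "nat \<Rightarrow> real"
  assumes V: "\<And>N. V N \<le> (real N + 1)\<^sup>2 * (\<sigma> N)\<^sup>2"
    and \<sigma>: "(\<lambda>N. (\<sigma> N)\<^sup>2) \<in> O(\<lambda>N. 1 / real N powr (2 + s))"
  obtains c where "\<forall>\<^sub>F N in sequentially. V N \<le> c * real N powr (- s)"
proof -
  obtain c where c: "c > 0" "\<forall>\<^sub>F N in sequentially. norm ((\<sigma> N)\<^sup>2) \<le> c * norm (1 / real N powr (2 + s))"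
    using \<sigma> by (elim landau_o.bigE)
  have "\<forall>\<^sub>F N in sequentially. V N \<le> 4 * c * real N powr (- s)"
    using c(2) eventually_ge_at_top[of 1]
  proof eventually_elim
    case (elim N)
    have "V N \<le> (2 * real N)\<^sup>2 * (c / real N powr (2 + s))"
      using elim by (intro order.trans[OF V] mult_mono power_mono) auto
    also have "\<dots> = 4 * c * (real N powr 2 / real N powr (2 + s))"
      using elim by (simp add: power_mult_distrib)
    also have "real N powr 2 / real N powr (2 + s) = real N powr (- s)"
      unfolding powr_diff[symmetric] by simp
    finally show ?case .
  qed
  then show ?thesis by (rule that)
qed

text \<open>The product filter lets n and N grow independently: a property holds eventually if it
  holds for all pairs beyond a common threshold.\<close>

theorem theorem6p6:
  fixes K :: "(real ^ 2) set"
    and \<theta> :: "nat \<Rightarrow> real"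
    and M :: "'w measure"
    and \<epsilon> :: "nat \<Rightarrow> nat \<Rightarrow> nat \<Rightarrow> 'w \<Rightarrow> real"
    and \<sigma> :: "nat \<Rightarrow> real"
    and angles :: "nat \<Rightarrow> real list"
    and noisy_moment :: "nat \<Rightarrow> 'w \<Rightarrow> nat \<Rightarrow> nat \<Rightarrow> real"
    and worst_error :: "nat \<times> nat \<Rightarrow> 'w \<Rightarrow> real"
  assumes K: "convex_body K" "K \<subseteq> unit_square"
    and \<theta>_range: "\<And>i. i \<ge> 1 \<Longrightarrow> \<theta> i \<in> {0..<2 * pi}"
    and \<theta>_dense: "{0..<2 * pi} \<subseteq> closure (\<theta> ` {1..})"
    and \<theta>_inj: "inj_on \<theta> {1..}"
    and \<theta>_init: "\<theta> 1 = 0" "\<theta> 2 = pi / 2" "\<theta> 3 = pi" "\<theta> 4 = 3 * pi / 2"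
    and M: "prob_space M" "complete_measure M"
    and \<epsilon>_rv: "\<And>N k l. k \<le> N \<Longrightarrow> l \<le> N \<Longrightarrow> \<epsilon> N k l \<in> borel_measurable M"
    and \<epsilon>_mean: "\<And>N k l. k \<le> N \<Longrightarrow> l \<le> N \<Longrightarrow>
           integrable M (\<epsilon> N k l) \<and> prob_space.expectation M (\<epsilon> N k l) = 0"
    and \<epsilon>_var: "\<And>N k l. k \<le> N \<Longrightarrow> l \<le> N \<Longrightarrow>
           integrable M (\<lambda>\<omega>. (\<epsilon> N k l \<omega>)\<^sup>2) \<and> prob_space.variance M (\<epsilon> N k l) \<le> (\<sigma> N)\<^sup>2"
  defines "angles \<equiv> \<lambda>n. sorted_list_of_set (\<theta> ` {1..n})"
    and "noisy_moment \<equiv> \<lambda>N \<omega> k l. legendre_moment k l K + \<epsilon> N k l \<omega>"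
    and "worst_error \<equiv> \<lambda>(n, N) \<omega>.
           SUP P\<in>least_squares_estimators N (noisy_moment N \<omega>) (angles n). nikodym_dist K P"
  shows "((\<exists>e>0. (\<lambda>N. (\<sigma> N)\<^sup>2) \<in> O(\<lambda>N. 1 / real N powr (2 + e))) \<longrightarrow>
           tendsto_in_mean M worst_error (\<lambda>_. 0) (sequentially \<times>\<^sub>F sequentially) \<and>
           tendsto_in_prob M worst_error (\<lambda>_. 0) (sequentially \<times>\<^sub>F sequentially)) \<and>
         ((\<exists>e>0. (\<lambda>N. (\<sigma> N)\<^sup>2) \<in> O(\<lambda>N. 1 / real N powr (3 + e))) \<longrightarrow>
           (AE \<omega> in M. ((\<lambda>nN. worst_error nN \<omega>) \<longlongrightarrow> 0) (sequentially \<times>\<^sub>F sequentially)))"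
proof -
  interpret prob_space M by fact
  define energy where "energy N \<omega> = (\<Sum>k\<le>N. \<Sum>l\<le>N. (\<epsilon> N k l \<omega>)\<^sup>2)" for N \<omega>
  have "interior K \<noteq> {}" and K': "compact K" "convex K"
    using K(1) by (auto simp: convex_body_def)
  then have "K \<noteq> {}" using interior_subset by fastforce
  note body = K' \<open>K \<noteq> {}\<close> K(2)
  have bK: "K \<in> sets borel" using K'(1) by (rule borel_compact)
  have ts: "set (angles n) = \<theta> ` {1..n}" for n
    by (simp add: angles_def)
  have four: "{1..4} = {1, 2, 3, 4::nat}" by auto
  have axes4: "{0, pi / 2, pi, 3 * pi / 2} \<subseteq> \<theta> ` {1..4}"
    unfolding four image_insert \<theta>_init by blast
  have axes: "{0, pi / 2, pi, 3 * pi / 2} \<subseteq> set (angles n)" if "n \<ge> 4" for n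
    using axes4 image_mono[of "{1..4}" "{1..n}" \<theta>] that by (auto simp: ts)
  have bounds: "0 \<le> worst_error (n, N) \<omega>" "worst_error (n, N) \<omega> \<le> 1" if "n \<ge> 4" for n N \<omega>
    using worst_error_bounds[OF axes[OF that] bK K(2)] by (simp_all add: worst_error_def)
  have meas: "worst_error (n, N) \<in> borel_measurable M" if "n \<ge> 4" for n N
    unfolding worst_error_def prod.case
    by (rule borel_measurable_worst_error[OF axes[OF that] bK K(2)]) (use \<epsilon>_rv in \<open>simp add: noisy_moment_def\<close>)
  have int: "integrable M (worst_error (n, N))" if "n \<ge> 4" for n N
    by (rule integrable_const_bound[where B = 1]) (use bounds[OF that] meas[OF that] in auto)
  have energy_int: "integrable M (energy N)" for N
    unfolding energy_def using \<epsilon>_var by (intro Bochner_Integration.integrable_sum) auto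
  have energy_nonneg: "0 \<le> energy N \<omega>" for N \<omega>
    unfolding energy_def by (intro sum_nonneg) auto
  \<comment> \<open>The means vanish, so the variance is the second moment.\<close>
  have second_moment: "expectation (\<lambda>\<omega>. (\<epsilon> N k l \<omega>)\<^sup>2) \<le> (\<sigma> N)\<^sup>2" if "k \<le> N" "l \<le> N" for N k l
    using variance_eq[of "\<epsilon> N k l"] \<epsilon>_mean[OF that] \<epsilon>_var[OF that] by simp
  have energy_le: "expectation (energy N) \<le> (real N + 1)\<^sup>2 * (\<sigma> N)\<^sup>2" for N
  proof -
    have "expectation (energy N) = (\<Sum>k\<le>N. \<Sum>l\<le>N. expectation (\<lambda>\<omega>. (\<epsilon> N k l \<omega>)\<^sup>2))"
      unfolding energy_def using \<epsilon>_var
      by (subst Bochner_Integration.integral_sum) (auto intro!: sum.cong Bochner_Integration.integral_sum)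
    also have "\<dots> \<le> (\<Sum>k\<le>N. \<Sum>l\<le>N. (\<sigma> N)\<^sup>2)"
      by (intro sum_mono second_moment) auto
    finally show ?thesis by (simp add: power2_eq_square algebra_simps)
  qed
  have stability: "\<exists>\<delta>>0. \<exists>N\<^sub>0\<ge>4. \<forall>n\<ge>N\<^sub>0. \<forall>N\<ge>N\<^sub>0. \<forall>\<omega>. energy N \<omega> \<le> \<delta> \<longrightarrow> worst_error (n, N) \<omega> \<le> \<eta>"
    if \<eta>: "\<eta> > 0" for \<eta>
  proof -
    obtain \<delta> N\<^sub>0 where *: "\<delta> > 0" "N\<^sub>0 \<ge> 4"
      "\<And>n N m. \<lbrakk>n \<ge> N\<^sub>0; N \<ge> N\<^sub>0; (\<Sum>k\<le>N. \<Sum>l\<le>N. (m k l - legendre_moment k l K)\<^sup>2) \<le> \<delta>\<rbrakk>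
         \<Longrightarrow> (SUP P\<in>least_squares_estimators N m (angles n). nikodym_dist K P) \<le> \<eta>"
      using worst_error_stability[OF body \<theta>_dense axes4 ts \<eta>] by blast
    have "worst_error (n, N) \<omega> \<le> \<eta>" if "n \<ge> N\<^sub>0" "N \<ge> N\<^sub>0" "energy N \<omega> \<le> \<delta>" for n N \<omega>
      using *(3)[OF that(1,2), of "noisy_moment N \<omega>"] that(3)
      by (simp add: worst_error_def noisy_moment_def energy_def)
    with *(1,2) show ?thesis by blast
  qed
  have in_mean: "tendsto_in_mean M worst_error (\<lambda>_. 0) (sequentially \<times>\<^sub>F sequentially)"
    if "e > 0" and \<sigma>: "(\<lambda>N. (\<sigma> N)\<^sup>2) \<in> O(\<lambda>N. 1 / real N powr (2 + e))" for e
  proof -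
    obtain c where c: "\<forall>\<^sub>F N in sequentially. expectation (energy N) \<le> c * real N powr (- e)"
      using noise_energy_bigo[OF energy_le \<sigma>] by blast
    have energy_lim: "(\<lambda>N. expectation (energy N)) \<longlonglongrightarrow> 0"
    proof (rule tendsto_sandwich[OF _ c tendsto_const])
      have "(\<lambda>N. real N powr (- e)) \<longlonglongrightarrow> 0"
        using \<open>e > 0\<close> by (intro tendsto_neg_powr filterlim_real_sequentially) simp
      then show "(\<lambda>N. c * real N powr (- e)) \<longlonglongrightarrow> 0"
        by (rule tendsto_mult_right_zero)
      show "\<forall>\<^sub>F N in sequentially. 0 \<le> expectation (energy N)"
        by (intro always_eventually allI Bochner_Integration.integral_nonneg energy_nonneg)
    qed
    have "((\<lambda>i. \<integral>\<omega>. \<bar>worst_error i \<omega>\<bar> \<partial>M) \<longlongrightarrow> 0) (sequentially \<times>\<^sub>F sequentially)"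
    proof (rule tendstoI)
      fix \<eta> :: real assume "\<eta> > 0"
      then obtain \<delta> N\<^sub>0 where \<delta>: "\<delta> > 0" "N\<^sub>0 \<ge> 4"
        "\<And>n N \<omega>. n \<ge> N\<^sub>0 \<Longrightarrow> N \<ge> N\<^sub>0 \<Longrightarrow> energy N \<omega> \<le> \<delta> \<Longrightarrow> worst_error (n, N) \<omega> \<le> \<eta> / 2"
        using stability[of "\<eta> / 2"] by auto
      \<comment> \<open>Division by \<delta> turns this threshold into the missing half of
        \<eta>.\<close>
      have "\<forall>\<^sub>F N in sequentially. expectation (energy N) < \<delta> * \<eta> / 2"
        using energy_lim \<delta>(1) \<open>\<eta> > 0\<close> by (intro order_tendstoD(2)) auto
      then obtain N1 where N1: "\<And>N. N \<ge> N1 \<Longrightarrow> expectation (energy N) < \<delta> * \<eta> / 2"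
        by (auto simp: eventually_sequentially)
      have "dist (\<integral>\<omega>. \<bar>worst_error (n, N) \<omega>\<bar> \<partial>M) 0 < \<eta>" if "n \<ge> max N\<^sub>0 N1" "N \<ge> max N\<^sub>0 N1" for n N
      proof -
        have n: "n \<ge> 4" "n \<ge> N\<^sub>0" and N: "N \<ge> N\<^sub>0" "N \<ge> N1" using that \<delta>(2) by auto
        \<comment> \<open>Markov's inequality in pointwise form: where the energy exceeds \<delta>,
          its quotient by \<delta> is at least 1 and dominates the trivial bound 1 on the worst
          error.\<close>
        have "\<bar>worst_error (n, N) \<omega>\<bar> \<le> \<eta> / 2 + energy N \<omega> / \<delta>" for \<omega>
        proof (cases "energy N \<omega> \<le> \<delta>")
          case True
          have "energy N \<omega> / \<delta> \<ge> 0" using \<delta>(1) energy_nonneg by simp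
          then show ?thesis using \<delta>(3)[OF n(2) N(1) True] bounds[OF n(1), of N \<omega>] by simp
        next
          case False
          then have "energy N \<omega> / \<delta> \<ge> 1" using \<delta>(1) by simp
          then show ?thesis using bounds[OF n(1), of N \<omega>] \<open>\<eta> > 0\<close> by simp
        qed
        then have "(\<integral>\<omega>. \<bar>worst_error (n, N) \<omega>\<bar> \<partial>M) \<le> (\<integral>\<omega>. \<eta> / 2 + energy N \<omega> / \<delta> \<partial>M)"
          using int[OF n(1)] energy_int by (intro integral_mono) auto
        also have "\<dots> = \<eta> / 2 + expectation (energy N) / \<delta>"
          using energy_int[of N] by (simp add: prob_space)
        also have "\<dots> < \<eta> / 2 + \<eta> / 2"
          using N1[OF N(2)] \<delta>(1) by (simp add: field_simps)
        finally show ?thesis by (simp add: Bochner_Integration.integral_nonneg)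
      qed
      then show "\<forall>\<^sub>F i in sequentially \<times>\<^sub>F sequentially. dist (\<integral>\<omega>. \<bar>worst_error i \<omega>\<bar> \<partial>M) 0 < \<eta>"
        unfolding eventually_prod_sequentially by blast
    qed
    moreover have "\<forall>\<^sub>F i in sequentially \<times>\<^sub>F sequentially. integrable M (worst_error i)"
      unfolding eventually_prod_sequentially using int by blast
    ultimately show ?thesis by (simp add: tendsto_in_mean_def)
  qed
  have almost_sure: "AE \<omega> in M. ((\<lambda>nN. worst_error nN \<omega>) \<longlongrightarrow> 0) (sequentially \<times>\<^sub>F sequentially)"
    if "e > 0" and \<sigma>: "(\<lambda>N. (\<sigma> N)\<^sup>2) \<in> O(\<lambda>N. 1 / real N powr (3 + e))" for e
  proof -
    \<comment> \<open>Two powers pay for the number of noise terms; the other 1 + e make the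
      expected energies summable.\<close>
    have "(\<lambda>N. (\<sigma> N)\<^sup>2) \<in> O(\<lambda>N. 1 / real N powr (2 + (1 + e)))"
      using \<sigma> by (simp add: add.assoc[symmetric])
    then obtain c where c: "\<forall>\<^sub>F N in sequentially. expectation (energy N) \<le> c * real N powr (- (1 + e))"
      using noise_energy_bigo[OF energy_le] by blast
    have "summable (\<lambda>N. expectation (energy N))"
    proof (rule summable_comparison_test_ev)
      show "\<forall>\<^sub>F N in sequentially. norm (expectation (energy N)) \<le> c * real N powr (- (1 + e))"
        using c by eventually_elim (simp add: Bochner_Integration.integral_nonneg energy_nonneg)
      show "summable (\<lambda>N. c * real N powr (- (1 + e)))"
        using \<open>e > 0\<close> by (intro summable_mult) (simp add: summable_real_powr_iff)
    qed
    then have "AE \<omega> in M. (\<lambda>N. energy N \<omega>) \<longlonglongrightarrow> 0"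
      by (rule AE_tendsto_0_of_summable_integral[OF energy_int energy_nonneg])
    then show ?thesis
    proof eventually_elim
      case (elim \<omega>)
      show ?case
      proof (rule tendstoI)
        fix \<eta> :: real assume "\<eta> > 0"
        then obtain \<delta> N\<^sub>0 where \<delta>: "\<delta> > 0" "N\<^sub>0 \<ge> 4"
          "\<And>n N \<omega>. n \<ge> N\<^sub>0 \<Longrightarrow> N \<ge> N\<^sub>0 \<Longrightarrow> energy N \<omega> \<le> \<delta> \<Longrightarrow> worst_error (n, N) \<omega> \<le> \<eta> / 2"
          using stability[of "\<eta> / 2"] by auto
        \<comment> \<open>Only this threshold depends on the sample point; \<delta> and
          \<open>N\<^sub>0\<close> do not.\<close>
        have "\<forall>\<^sub>F N in sequentially. energy N \<omega> < \<delta>"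
          using elim \<delta>(1) by (rule order_tendstoD(2))
        then obtain N1 where N1: "\<And>N. N \<ge> N1 \<Longrightarrow> energy N \<omega> < \<delta>"
          by (auto simp: eventually_sequentially)
        have "dist (worst_error (n, N) \<omega>) 0 < \<eta>" if "n \<ge> max N\<^sub>0 N1" "N \<ge> max N\<^sub>0 N1" for n N
        proof -
          have n: "n \<ge> 4" "n \<ge> N\<^sub>0" and N: "N \<ge> N\<^sub>0" "N \<ge> N1" using that \<delta>(2) by auto
          show ?thesis
            using \<delta>(3)[OF n(2) N(1) less_imp_le[OF N1[OF N(2)]]] bounds(1)[OF n(1), of N \<omega>] \<open>\<eta> > 0\<close> by simp
        qed
        then show "\<forall>\<^sub>F nN in sequentially \<times>\<^sub>F sequentially. dist (worst_error nN \<omega>) 0 < \<eta>"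
          unfolding eventually_prod_sequentially by blast
      qed
    qed
  qed
  show ?thesis
    using in_mean almost_sure tendsto_in_mean_imp_in_prob by blast
qed

end
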